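(* Let $X$ be a separable Banach space. If there exists a Lipschitz retraction from $X$ onto a small compact subset of $X$, then $X$ has the $\pi$-property.
   Context: All Banach spaces are real. A retraction from $X$ onto $K\subset X$ is a map $R:X\to K$ with $R|_K=\mathrm{Id}_K$. $X$ has the $\pi$-property if there is a uniformly bounded net of finite rank (bounded linear) projections on $X$ converging strongly (pointwise in norm) to the identity of $X$. A fundamental sequence in $X$ is a sequence $\beta=(e_n)\subset X$ whose closed linear span is $X$; put $E_n^\beta=\mathrm{span}\{e_1,\dots,e_n\}$. For a bounded set $K\subset X$ define the inner radii $r_n^\beta=\sup\{r\ge0: B_{E_n^\beta}(x,r)\subset K\cap E_n^\beta \text{ for some } x\in E_n^\beta\}$, where $B_{E_n^\beta}(x,r)$ is the closed ball in $E_n^\beta$ with centre $x$ and radius $r$, and the heights $h_n^\beta=\sup\{d(x,E_n^\beta): x\in K\}$. A bounded set $K\subset X$ is small if there exist $\varepsilon\in(0,1)$, a fundamental sequence $\beta$ in $X$ and a strictly increasing $\sigma:\mathbb{N}\to\mathbb{N}$ such that for all $n\in\mathbb{N}$ $$0<\frac{h_{\sigma(n)}^\beta}{r_{\sigma(n)}^\beta}\le\frac{1}{2\sigma(n)^2\left(\left(1+\frac{2}{\varepsilon}\right)^{\sigma(n)}+2\right)}.$$ *)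

theory Defs
  imports "HOL-Analysis.Analysis"
begin

text \<open>Sequences are indexed from 0, so \<open>e i\<close> is the \<open>(i+1)\<close>-st vector and
  \<open>seq_span e n\<close> is the span of the first \<open>n\<close> vectors.\<close>

definition fundamental_seq :: "(nat \<Rightarrow> 'a::real_normed_vector) \<Rightarrow> bool" where
  "fundamental_seq e \<longleftrightarrow> closure (span (range e)) = UNIV"

definition seq_span :: "(nat \<Rightarrow> 'a::real_normed_vector) \<Rightarrow> nat \<Rightarrow> 'a set" where
  "seq_span e n = span (e ` {..<n})"

text \<open>The suprema are taken in \<open>[0,\<infinity>]\<close>: the inner radius is 0 if \<open>K\<close> contains no point of
  \<open>seq_span e n\<close>, and it is \<open>\<infinity>\<close> in the degenerate case \<open>seq_span e n = {0}\<close>, \<open>0 \<in> K\<close>.\<close>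

definition inner_radius :: "(nat \<Rightarrow> 'a::real_normed_vector) \<Rightarrow> 'a set \<Rightarrow> nat \<Rightarrow> ennreal" where
  "inner_radius e K n =
     Sup {ennreal r | r. 0 \<le> r \<and>
       (\<exists>x\<in>seq_span e n. cball x r \<inter> seq_span e n \<subseteq> K \<inter> seq_span e n)}"

definition height :: "(nat \<Rightarrow> 'a::real_normed_vector) \<Rightarrow> 'a set \<Rightarrow> nat \<Rightarrow> ennreal" where
  "height e K n = (SUP x\<in>K. ennreal (infdist x (seq_span e n)))"

text \<open>The values of \<open>\<sigma>\<close> are positive, as they are lengths of initial segments numbered from 1.
  In \<open>ennreal\<close>, \<open>0 / 0 = 0\<close>, \<open>x / \<infinity> = 0\<close>, and \<open>x / 0 = \<infinity>\<close> for \<open>x > 0\<close>,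
  so the two inequalities force both the inner radius and the height to be positive and finite.\<close>

definition small_set :: "'a::real_normed_vector set \<Rightarrow> bool" where
  "small_set K \<longleftrightarrow> bounded K \<and>
     (\<exists>\<epsilon> e \<sigma>. 0 < \<epsilon> \<and> \<epsilon> < (1::real) \<and> fundamental_seq e \<and>
        strict_mono \<sigma> \<and> (\<forall>n::nat. 1 \<le> \<sigma> n) \<and>
        (\<forall>n. 0 < height e K (\<sigma> n) / inner_radius e K (\<sigma> n) \<and>
             height e K (\<sigma> n) / inner_radius e K (\<sigma> n)
               \<le> ennreal (1 / (2 * real (\<sigma> n)^2 * ((1 + 2 / \<epsilon>) ^ \<sigma> n + 2)))))"

definition finite_rank_projection :: "('a::real_normed_vector \<Rightarrow>\<^sub>L 'a) \<Rightarrow> bool" where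
  "finite_rank_projection P \<longleftrightarrow>
     P o\<^sub>L P = P \<and> (\<exists>B. finite B \<and> range (blinfun_apply P) = span B)"

definition directed_set :: "'i set \<Rightarrow> ('i \<Rightarrow> 'i \<Rightarrow> bool) \<Rightarrow> bool" where
  "directed_set I le \<longleftrightarrow> I \<noteq> {} \<and>
     (\<forall>i\<in>I. le i i) \<and>
     (\<forall>i\<in>I. \<forall>j\<in>I. \<forall>k\<in>I. le i j \<longrightarrow> le j k \<longrightarrow> le i k) \<and>
     (\<forall>i\<in>I. \<forall>j\<in>I. \<exists>k\<in>I. le i k \<and> le j k)"

definition pi_net ::
  "'i set \<Rightarrow> ('i \<Rightarrow> 'i \<Rightarrow> bool) \<Rightarrow> ('i \<Rightarrow> ('a::real_normed_vector \<Rightarrow>\<^sub>L 'a)) \<Rightarrow> bool" where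
  "pi_net I le P \<longleftrightarrow> directed_set I le \<and>
     (\<forall>i\<in>I. finite_rank_projection (P i)) \<and>
     (\<exists>M. \<forall>i\<in>I. norm (P i) \<le> M) \<and>
     (\<forall>x. \<forall>\<delta>>0. \<exists>i\<in>I. \<forall>j\<in>I. le i j \<longrightarrow> norm (blinfun_apply (P j) x - x) < \<delta>)"

text \<open>HOL cannot quantify over the type of the index set of a net, so one type has to be fixed.
  The fixed type suffices for nets over arbitrary directed sets, see \<open>pi_propertyI\<close>.\<close>

definition pi_property :: "'a::real_normed_vector itself \<Rightarrow> bool" where
  "pi_property (_ :: 'a itself) \<longleftrightarrow>
     (\<exists>(I :: ('a set \<times> nat) set) le (P :: 'a set \<times> nat \<Rightarrow> ('a \<Rightarrow>\<^sub>L 'a)). pi_net I le P)"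

lemma directed_set_finite_subsets:
  "directed_set {p :: 'a set \<times> nat. finite (fst p)} (\<lambda>p q. fst p \<subseteq> fst q \<and> snd p \<le> snd q)"
  unfolding directed_set_def
proof (intro conjI ballI impI)
  show "{p :: 'a set \<times> nat. finite (fst p)} \<noteq> {}"
    using finite.emptyI[where 'a='a] by (metis (mono_tags) empty_iff fst_conv mem_Collect_eq)
next
  fix i j :: "'a set \<times> nat"
  assume "i \<in> {p. finite (fst p)}" "j \<in> {p. finite (fst p)}"
  then show "\<exists>k\<in>{p. finite (fst p)}. (fst i \<subseteq> fst k \<and> snd i \<le> snd k) \<and> fst j \<subseteq> fst k \<and> snd j \<le> snd k"
    by (intro bexI[of _ "(fst i \<union> fst j, max (snd i) (snd j))"]) auto
qed auto

lemma directed_set_finite_bound: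
  assumes "directed_set I le" "finite A" "\<And>x. x \<in> A \<Longrightarrow> f x \<in> I"
  shows "\<exists>k\<in>I. \<forall>x\<in>A. le (f x) k"
  using assms(2,3)
proof (induction A rule: finite_induct)
  case empty
  have "I \<noteq> {}" using assms(1) unfolding directed_set_def by (elim conjE)
  then show ?case by blast
next
  case (insert a A)
  have "\<exists>k\<in>I. \<forall>x\<in>A. le (f x) k" by (rule insert.IH) (simp add: insert.prems)
  then obtain k where k: "k \<in> I" "\<forall>x\<in>A. le (f x) k" by blast
  have "f a \<in> I" using insert.prems by simp
  moreover have "\<forall>i\<in>I. \<forall>j\<in>I. \<exists>k\<in>I. le i k \<and> le j k"
    using assms(1) unfolding directed_set_def by (elim conjE)
  ultimately obtain l where l: "l \<in> I" "le (f a) l" "le k l"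
    using k(1) by blast
  have trans: "le i l" if "i \<in> I" "le i k" for i
  proof -
    have "\<forall>i\<in>I. \<forall>j\<in>I. \<forall>k\<in>I. le i j \<longrightarrow> le j k \<longrightarrow> le i k"
      using assms(1) unfolding directed_set_def by (elim conjE)
    with k(1) l(1,3) that show ?thesis by blast
  qed
  have "le (f x) l" if "x \<in> A" for x
    using k(2) that insert.prems[of x] by (intro trans) simp_all
  with l show ?case by blast
qed

lemma pi_propertyI:
  fixes P :: "'i \<Rightarrow> ('a::real_normed_vector \<Rightarrow>\<^sub>L 'a)"
  assumes "pi_net I le P"
  shows "pi_property TYPE('a)"
proof -
  let ?J = "{p :: 'a set \<times> nat. finite (fst p)}"
  have dir: "directed_set I le" and fr: "\<And>i. i \<in> I \<Longrightarrow> finite_rank_projection (P i)"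
    and conv: "\<And>x \<delta>. \<delta> > 0 \<Longrightarrow> \<exists>i\<in>I. \<forall>j\<in>I. le i j \<longrightarrow> norm (blinfun_apply (P j) x - x) < \<delta>"
    using assms by (auto simp: pi_net_def)
  obtain M where M: "\<And>i. i \<in> I \<Longrightarrow> norm (P i) \<le> M"
    using assms unfolding pi_net_def by blast
  have "\<exists>k\<in>I. \<forall>x\<in>fst p. norm (blinfun_apply (P k) x - x) < 1 / real (Suc (snd p))"
    if p: "p \<in> ?J" for p
  proof -
    have "\<forall>x. \<exists>i\<in>I. \<forall>j\<in>I. le i j \<longrightarrow> norm (blinfun_apply (P j) x - x) < 1 / real (Suc (snd p))"
      by (intro allI conv) simp
    then obtain f where f: "\<And>x. f x \<in> I"
      "\<And>x j. j \<in> I \<Longrightarrow> le (f x) j \<Longrightarrow> norm (blinfun_apply (P j) x - x) < 1 / real (Suc (snd p))"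
      by metis
    obtain k where "k \<in> I" "\<forall>x\<in>fst p. le (f x) k"
      using directed_set_finite_bound[OF dir, of "fst p" f] p f(1) by blast
    then show ?thesis by (intro bexI[of _ k] ballI f(2)) simp_all
  qed
  then obtain g where g: "\<And>p. p \<in> ?J \<Longrightarrow> g p \<in> I"
    "\<And>p x. p \<in> ?J \<Longrightarrow> x \<in> fst p \<Longrightarrow> norm (blinfun_apply (P (g p)) x - x) < 1 / real (Suc (snd p))"
    by metis
  have lim: "\<exists>p\<in>?J. \<forall>q\<in>?J. fst p \<subseteq> fst q \<and> snd p \<le> snd q \<longrightarrow>
      norm (blinfun_apply (P (g q)) x - x) < \<delta>" if "\<delta> > 0" for x and \<delta> :: real
  proof -
    obtain n where n: "1 / real (Suc n) < \<delta>"
      using \<open>\<delta> > 0\<close> nat_approx_posE by blast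
    show ?thesis
    proof (intro bexI[of _ "({x}, n)"] ballI impI)
      fix q assume q: "q \<in> ?J" "fst ({x}, n) \<subseteq> fst q \<and> snd ({x}, n) \<le> snd q"
      have "norm (blinfun_apply (P (g q)) x - x) < 1 / real (Suc (snd q))"
        using g(2)[of q x] q by auto
      also have "\<dots> \<le> 1 / real (Suc n)"
        using q by (intro divide_left_mono) auto
      finally show "norm (blinfun_apply (P (g q)) x - x) < \<delta>" using n by simp
    qed simp
  qed
  have "pi_net ?J (\<lambda>p q. fst p \<subseteq> fst q \<and> snd p \<le> snd q) (\<lambda>p. P (g p))"
    unfolding pi_net_def
  proof (intro conjI allI impI)
    show "\<forall>p\<in>?J. finite_rank_projection (P (g p))" using fr g(1) by blast
    show "\<exists>M. \<forall>p\<in>?J. norm (P (g p)) \<le> M" using M g(1) by blast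
  qed (rule directed_set_finite_subsets, erule lim)
  then show ?thesis unfolding pi_property_def by blast
qed

end

theory Submission
  imports Defs
begin

text \<open>
  Let \<open>E\<close> be one of the spaces \<open>seq_span e (\<sigma> n)\<close>, of dimension \<open>d\<close>. By trace duality, \<open>E\<close> is the range
  of a projection of norm about \<open>C\<close> as soon as every operator \<open>S = \<Sum>i. \<phi> i \<otimes> x i\<close> that maps \<open>E\<close> into
  itself has trace at most \<open>C * (\<Sum>i. norm (x i))\<close> on \<open>E\<close>; here it is enough to let \<open>\<phi> i\<close> run
  through functionals that norm an \<open>\<epsilon>'\<close>-net of the sphere of \<open>E\<close>, so that there are at most
  \<open>(1 + 2 / \<epsilon>') ^ d\<close> of them. To bound the trace, average the retraction over a small cube spanned by
  the \<open>x i\<close> and a cube spanned by a basis of \<open>E\<close>. The average is differentiable along these vectors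
  with a linear derivative of norm at most \<open>L\<close>. The derivative is close to the identity on \<open>E\<close>, because the
  retraction fixes a large ball of \<open>E\<close>, and it maps each \<open>x i\<close> close to \<open>E\<close>, because \<open>K\<close> lies
  close to \<open>E\<close>. Choosing \<open>\<epsilon>'\<close> strictly between \<open>\<epsilon>\<close> and 1 gains an exponential factor that absorbs
  all polynomial losses in the dimension.
\<close>

section \<open>Hahn--Banach extension and finite-dimensional subspaces\<close>

text \<open>A linear subspace \<open>G\<close> with \<open>a \<le> p x\<close> for all \<open>(x, a) \<in> G\<close> is automatically the graph of a
  function, since \<open>p 0 = 0\<close>. Hence Zorn's lemma can be applied to such subspaces directly.\<close>

lemma hahn_banach_graph:
  fixes p :: "'v::real_vector \<Rightarrow> real" and G :: "('v \<times> real) set"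
  assumes add: "\<And>x y. p (x + y) \<le> p x + p y"
    and scale: "\<And>c x. 0 \<le> c \<Longrightarrow> p (c *\<^sub>R x) = c * p x"
    and G: "subspace G" "\<And>x a. (x, a) \<in> G \<Longrightarrow> a \<le> p x"
  obtains f where "linear f" "\<And>x. f x \<le> p x" "\<And>x a. (x, a) \<in> G \<Longrightarrow> f x = a"
proof -
  define A where "A = {H. G \<subseteq> H \<and> subspace H \<and> (\<forall>x a. (x, a) \<in> H \<longrightarrow> a \<le> p x)}"
  have "\<exists>M\<in>A. \<forall>X\<in>A. M \<subseteq> X \<longrightarrow> X = M"
  proof (rule subset_Zorn_nonempty)
    show "A \<noteq> {}" using G by (auto simp: A_def)
    fix C assume C: "C \<noteq> {}" "subset.chain A C"
    then have CA: "C \<subseteq> A" and tot: "\<And>H H'. H \<in> C \<Longrightarrow> H' \<in> C \<Longrightarrow> H \<subseteq> H' \<or> H' \<subseteq> H"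
      by (auto simp: subset_chain_def)
    have "subspace (\<Union>C)"
      unfolding subspace_def
    proof (intro conjI allI ballI)
      show "0 \<in> \<Union>C" using C(1) CA by (auto simp: A_def subspace_def)
      fix u assume "u \<in> \<Union>C"
      then obtain H where H: "H \<in> C" "u \<in> H" by blast
      then show "c *\<^sub>R u \<in> \<Union>C" for c using CA by (auto simp: A_def subspace_def)
      fix v assume "v \<in> \<Union>C"
      then obtain H' where H': "H' \<in> C" "v \<in> H'" by blast
      have sub: "subspace H" "subspace H'" using H H' CA by (auto simp: A_def)
      consider "H \<subseteq> H'" | "H' \<subseteq> H" using tot H H' by blast
      then show "u + v \<in> \<Union>C"
      proof cases
        case 1
        then have "u + v \<in> H'" using H H' by (intro subspace_add sub) auto
        then show ?thesis using H' by blast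
      next
        case 2
        then have "u + v \<in> H" using H H' by (intro subspace_add sub) auto
        then show ?thesis using H by blast
      qed
    qed
    moreover have "G \<subseteq> \<Union>C" using C(1) CA unfolding A_def by blast
    ultimately show "\<Union>C \<in> A" using CA unfolding A_def by blast
  qed
  then obtain M where M: "G \<subseteq> M" "subspace M" "\<And>x a. (x, a) \<in> M \<Longrightarrow> a \<le> p x"
    and max: "\<And>H. H \<in> A \<Longrightarrow> M \<subseteq> H \<Longrightarrow> H = M"
    by (auto simp: A_def)
  have p0: "p 0 = 0" using scale[of 0 0] by simp
  \<comment> \<open>Adjoining \<open>(x, c)\<close> for a suitable value \<open>c\<close> stays
    below \<open>p\<close>, so maximality forces \<open>(x, c)\<close> to lie in \<open>M\<close>
    already.\<close>
  have dom: "\<exists>a. (x, a) \<in> M" for x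
  proof -
    have ineq: "a - p (y - x) \<le> p (y' + x) - a'" if "(y, a) \<in> M" "(y', a') \<in> M" for y a y' a'
    proof -
      have "(y + y', a + a') \<in> M" using subspace_add[OF M(2) that] by simp
      then have "a + a' \<le> p (y + y')" by (rule M(3))
      also have "\<dots> \<le> p (y - x) + p (y' + x)" using add[of "y - x" "y' + x"] by simp
      finally show ?thesis by simp
    qed
    \<comment> \<open>\<open>ineq\<close> puts every lower constraint \<open>a - p (y - x)\<close>
      below every upper constraint \<open>p (y + x) - a\<close>; the supremum of the former
      satisfies both.\<close>
    define c where "c = (SUP z\<in>M. snd z - p (fst z - x))"
    have zM: "(0, 0) \<in> M" using subspace_0[OF M(2)] by (simp add: zero_prod_def)
    have bdd: "bdd_above ((\<lambda>z. snd z - p (fst z - x)) ` M)"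
      using ineq[OF _ zM] by (intro bdd_aboveI[of _ "p x"]) (auto split: prod.splits)
    have lo: "a - p (y - x) \<le> c" if "(y, a) \<in> M" for y a
      using cSUP_upper[OF that bdd] by (simp add: c_def)
    have hi: "c \<le> p (y + x) - a" if "(y, a) \<in> M" for y a
      unfolding c_def using zM ineq[OF _ that] by (intro cSUP_least) auto
    define H where "H = span (insert (x, c) M)"
    have spM: "span M = M" using M(2) by (simp add: span_eq_iff)
    have "b \<le> p y" if "(y, b) \<in> H" for y b
    proof -
      have "\<exists>k. (y, b) - k *\<^sub>R (x, c) \<in> M"
        using that unfolding H_def span_insert spM by blast
      then obtain k where k: "(y - k *\<^sub>R x, b - k * c) \<in> M" by auto
      consider "k = 0" | "k > 0" | "k < 0" by linarith
      then show ?thesis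
      proof cases
        case 1 then show ?thesis using M(3)[OF k] by simp
      next
        case 2
        have "(1 / k) *\<^sub>R (y - k *\<^sub>R x, b - k * c) \<in> M" by (rule subspace_scale[OF M(2) k])
        from this[simplified, THEN hi] 2 have "c \<le> p ((1 / k) *\<^sub>R y) - (b - k * c) / k"
          by (simp add: algebra_simps)
        also have "p ((1 / k) *\<^sub>R y) = p y / k" using scale[of "1/k" y] 2 by simp
        finally show ?thesis using 2 by (simp add: field_simps)
      next
        case 3
        have "(- 1 / k) *\<^sub>R (y - k *\<^sub>R x, b - k * c) \<in> M" by (rule subspace_scale[OF M(2) k])
        from this[simplified, THEN lo] 3 have "- ((b - k * c) / k) - p ((- 1 / k) *\<^sub>R y) \<le> c"
          by (simp add: algebra_simps)
        also have "p ((- 1 / k) *\<^sub>R y) = - p y / k" using scale[of "- 1/k" y] 3 by simp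
        finally show ?thesis using 3 by (simp add: field_simps)
      qed
    qed
    moreover have "M \<subseteq> H" "(x, c) \<in> H" by (auto simp: H_def intro: span_base)
    ultimately have "H = M" using M(1) by (intro max) (auto simp: A_def H_def)
    then show ?thesis using \<open>(x, c) \<in> H\<close> by blast
  qed
  have uniq: "a = b" if "(x, a) \<in> M" "(x, b) \<in> M" for x a b
  proof -
    have "(0, a - b) \<in> M" "(0, b - a) \<in> M"
      using subspace_diff[OF M(2) that] subspace_diff[OF M(2) that(2,1)] by simp_all
    from this[THEN M(3)] show ?thesis using p0 by simp
  qed
  obtain f where f: "\<And>x. (x, f x) \<in> M" using dom by metis
  have "linear f"
  proof (rule linearI)
    show "f (x + y) = f x + f y" for x y
      using subspace_add[OF M(2) f f, of x y] by (intro uniq[OF f]) simp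
    show "f (c *\<^sub>R x) = c *\<^sub>R f x" for c x
      using subspace_scale[OF M(2) f, of c x] by (intro uniq[OF f]) simp
  qed
  moreover have "f x \<le> p x" for x using M(3) f by blast
  moreover have "f x = a" if "(x, a) \<in> G" for x a using uniq f M(1) that by blast
  ultimately show thesis by (rule that)
qed

text \<open>The graph of \<open>g\<close> over \<open>E\<close> is a subspace dominated by
  \<open>B * norm x\<close>; the two-sided bound follows from the one-sided one at
  \<open>- x\<close>.\<close>

lemma hahn_banach_subspace:
  fixes g :: "'a::real_normed_vector \<Rightarrow> real"
  assumes E: "subspace E" and g: "linear g" and bound: "\<And>y. y \<in> E \<Longrightarrow> \<bar>g y\<bar> \<le> B * norm y"
    and B: "0 \<le> B"
  obtains f where "linear f" "\<And>x. \<bar>f x\<bar> \<le> B * norm x" "\<And>y. y \<in> E \<Longrightarrow> f y = g y"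
proof -
  define G where "G = (\<lambda>y. (y, g y)) ` E"
  have sub: "subspace G" unfolding G_def using E g
    by (intro linear_subspace_image) (auto intro!: linearI simp: linear_add linear_scale)
  have tri: "B * norm (x + y) \<le> B * norm x + B * norm y" for x y :: 'a
    using mult_left_mono[OF norm_triangle_ineq B] by (simp add: distrib_left)
  have le: "a \<le> B * norm x" if "(x, a) \<in> G" for x a
    using that bound abs_le_D1 by (auto simp: G_def)
  obtain f where f: "linear f" "\<And>x. f x \<le> B * norm x" "\<And>x a. (x, a) \<in> G \<Longrightarrow> f x = a"
    by (rule hahn_banach_graph[OF tri _ sub le]) auto
  have "\<bar>f x\<bar> \<le> B * norm x" for x
    using f(2)[of x] f(2)[of "- x"] by (simp add: linear_neg[OF f(1)] abs_le_iff)
  moreover have "f y = g y" if "y \<in> E" for y using f(3) that by (auto simp: G_def)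
  ultimately show thesis using f(1) that by blast
qed

text \<open>Hahn-Banach for the line through \<open>(y, norm y)\<close>; in graph form this covers
  \<open>y = 0\<close> as well.\<close>

lemma norming_functional:
  fixes y :: "'a::real_normed_vector"
  obtains f where "linear f" "\<And>x. \<bar>f x\<bar> \<le> norm x" "f y = norm y"
proof -
  define G where "G = range (\<lambda>t. (t *\<^sub>R y, t * norm y))"
  have sub: "subspace G" unfolding G_def
    by (intro linear_subspace_image) (auto intro!: linearI simp: algebra_simps)
  have le: "a \<le> norm x" if "(x, a) \<in> G" for x a
    using that by (auto simp: G_def intro!: mult_right_mono)
  obtain f where f: "linear f" "\<And>x. f x \<le> norm x" "\<And>x a. (x, a) \<in> G \<Longrightarrow> f x = a"
    by (rule hahn_banach_graph[OF norm_triangle_ineq _ sub le]) auto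
  have "\<bar>f x\<bar> \<le> norm x" for x
    using f(2)[of x] f(2)[of "- x"] by (simp add: linear_neg[OF f(1)] abs_le_iff)
  moreover have "(y, norm y) \<in> G" unfolding G_def by (rule image_eqI[of _ _ 1]) auto
  ultimately show thesis using f that by blast
qed

section \<open>Closedness of finite-dimensional subspaces and continuity of coordinates\<close>

text \<open>Induction on \<open>B\<close>: a new vector \<open>a\<close> has positive distance from
  the closed subspace \<open>span B\<close>, and this distance controls the coefficient of
  \<open>a\<close> by the norm. Along a convergent sequence the coefficients are therefore
  Cauchy.\<close>

lemma closed_span_finite:
  fixes B :: "'a::banach set"
  assumes "finite B"
  shows "closed (span B)"
  using assms
proof (induction B rule: finite_induct)
  case empty then show ?case by simp
next
  case (insert a B)
  show ?case
  proof (cases "a \<in> span B")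
    case True then show ?thesis using insert.IH by (simp add: span_redundant)
  next
    case False
    define \<delta> where "\<delta> = infdist a (span B)"
    have \<delta>: "\<delta> > 0" unfolding \<delta>_def
      using insert.IH False by (intro infdist_pos_not_in_closed) (auto intro: span_zero)
    have low: "\<bar>t\<bar> * \<delta> \<le> norm (t *\<^sub>R a + w)" if "w \<in> span B" for t w
    proof (cases "t = 0")
      case False
      have "- (1 / t) *\<^sub>R w \<in> span B" using that by (rule span_scale)
      then have "\<delta> \<le> dist a (- (1 / t) *\<^sub>R w)" unfolding \<delta>_def by (rule infdist_le)
      then have "\<bar>t\<bar> * \<delta> \<le> \<bar>t\<bar> * norm (a + (1 / t) *\<^sub>R w)"
        by (intro mult_left_mono) (auto simp: dist_norm)
      also have "\<dots> = norm (t *\<^sub>R (a + (1 / t) *\<^sub>R w))" by simp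
      finally show ?thesis using False by (simp add: scaleR_add_right)
    qed simp
    show ?thesis unfolding closed_sequential_limits
    proof (intro allI impI, elim conjE)
      fix y l assume y: "\<forall>n. y n \<in> span (insert a B)" and lim: "y \<longlonglongrightarrow> l"
      have "\<forall>n. \<exists>t. y n - t *\<^sub>R a \<in> span B" using y by (simp add: span_insert)
      then obtain t where t: "\<And>n. y n - t n *\<^sub>R a \<in> span B" by metis
      have "Cauchy t"
      proof (rule metric_CauchyI)
        fix e :: real assume "e > 0"
        then obtain N where N: "\<And>m n. m \<ge> N \<Longrightarrow> n \<ge> N \<Longrightarrow> dist (y m) (y n) < e * \<delta>"
          using LIMSEQ_imp_Cauchy[OF lim] \<delta> by (meson metric_CauchyD mult_pos_pos)
        have "dist (t m) (t n) < e" if "m \<ge> N" "n \<ge> N" for m n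
        proof -
          have "\<bar>t m - t n\<bar> * \<delta> \<le> norm ((t m - t n) *\<^sub>R a + ((y m - t m *\<^sub>R a) - (y n - t n *\<^sub>R a)))"
            by (intro low span_diff t)
          also have "\<dots> = dist (y m) (y n)" by (simp add: dist_norm algebra_simps)
          also have "\<dots> < e * \<delta>" by (rule N[OF that])
          finally show ?thesis using \<delta> by (simp add: dist_real_def)
        qed
        then show "\<exists>M. \<forall>m\<ge>M. \<forall>n\<ge>M. dist (t m) (t n) < e" by blast
      qed
      then obtain T where "t \<longlonglongrightarrow> T" using Cauchy_convergent convergent_def by blast
      then have "(\<lambda>n. y n - t n *\<^sub>R a) \<longlonglongrightarrow> l - T *\<^sub>R a" by (intro tendsto_intros lim)
      then have "l - T *\<^sub>R a \<in> span B" by (rule closed_sequentially[OF insert.IH t])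
      then show "l \<in> span (insert a B)" by (auto simp: span_insert)
    qed
  qed
qed

text \<open>\<open>g\<close> vanishes on \<open>span (B - {a})\<close>, which is closed and at
  positive distance from \<open>a\<close>; the reciprocal of this distance serves as
  \<open>C\<close>.\<close>

lemma bounded_coordinate:
  fixes B :: "'a::banach set"
  assumes B: "finite B" "independent B" "a \<in> B"
    and g: "linear g" "g a = (1::real)" "\<And>b. b \<in> B \<Longrightarrow> b \<noteq> a \<Longrightarrow> g b = 0"
  obtains C where "0 \<le> C" "\<And>y. y \<in> span B \<Longrightarrow> \<bar>g y\<bar> \<le> C * norm y"
proof -
  define \<delta> where "\<delta> = infdist a (span (B - {a}))"
  have "a \<notin> span (B - {a})" using B(2,3) by (auto simp: dependent_def)
  then have \<delta>: "\<delta> > 0" unfolding \<delta>_def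
    using closed_span_finite[of "B - {a}"] B(1)
    by (intro infdist_pos_not_in_closed) (auto intro: span_zero)
  have "\<bar>g y\<bar> \<le> 1 / \<delta> * norm y" if y: "y \<in> span B" for y
  proof -
    have "insert a (B - {a}) = B" using B(3) by blast
    then obtain t where t: "y - t *\<^sub>R a \<in> span (B - {a})"
      using y span_insert[of a "B - {a}"] by auto
    have "g (y - t *\<^sub>R a) = 0"
      by (rule linear_eq_0_on_span[OF g(1) _ t]) (auto intro: g(3))
    then have gy: "g y = t" using g(1,2) by (simp add: linear_diff linear_scale)
    show ?thesis
    proof (cases "t = 0")
      case False
      have "- (1 / t) *\<^sub>R (y - t *\<^sub>R a) \<in> span (B - {a})" using t by (rule span_scale)
      then have "\<delta> \<le> dist a (- (1 / t) *\<^sub>R (y - t *\<^sub>R a))" unfolding \<delta>_def by (rule infdist_le)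
      also have "\<dots> = norm y / \<bar>t\<bar>" using False by (simp add: dist_norm scaleR_diff_right)
      finally show ?thesis using False \<delta> gy by (simp add: field_simps)
    qed (use gy \<delta> in simp)
  qed
  then show thesis using that[of "1 / \<delta>"] \<delta> by simp
qed

section \<open>Almost Auerbach bases and nets\<close>

text \<open>The basis nearly maximises a determinant over the unit ball of \<open>span B\<close>, and the coordinate
  functionals are quotients of determinants by Cramer's rule.\<close>

lemma near_auerbach_basis:
  fixes B :: "'a::banach set"
  assumes B: "finite B" "independent B"
  obtains b :: "nat \<Rightarrow> 'a" and g :: "nat \<Rightarrow> 'a \<Rightarrow> real" where
    "\<And>k. k < card B \<Longrightarrow> b k \<in> span B" "\<And>k. k < card B \<Longrightarrow> norm (b k) \<le> 1"
    "\<And>k. k < card B \<Longrightarrow> linear (g k)" "\<And>k x. k < card B \<Longrightarrow> \<bar>g k x\<bar> \<le> 2 * norm x"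
    "\<And>y. y \<in> span B \<Longrightarrow> (\<Sum>k<card B. g k y *\<^sub>R b k) = y"
proof -
  define d where "d = card B"
  obtain e where e: "bij_betw e {..<d} B"
    using ex_bij_betw_nat_finite[OF B(1)] by (auto simp: d_def lessThan_atLeast0)
  have eB: "e i \<in> B" if "i < d" for i using e that by (auto simp: bij_betw_def)
  have einj: "e i = e j \<longleftrightarrow> i = j" if "i < d" "j < d" for i j
    using e that by (auto simp: bij_betw_def inj_on_def)
  have "\<forall>i. \<exists>c. linear c \<and> (\<forall>x\<in>B. c x = (if x = e i then 1 else 0::real))"
    by (intro allI linear_independent_extend[OF B(2)])
  then obtain c where c: "\<And>i. linear (c i)" "\<And>i x. x \<in> B \<Longrightarrow> c i x = (if x = e i then 1 else 0::real)"
    by metis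
  have "\<exists>C\<ge>0. \<forall>y\<in>span B. \<bar>c i y\<bar> \<le> C * norm y" if i: "i < d" for i
  proof -
    obtain C where "0 \<le> C" "\<And>y. y \<in> span B \<Longrightarrow> \<bar>c i y\<bar> \<le> C * norm y"
      by (rule bounded_coordinate[OF B eB[OF i] c(1), of i]) (simp_all add: c(2) eB[OF i])
    then show ?thesis by blast
  qed
  then obtain C where C: "\<And>i. i < d \<Longrightarrow> 0 \<le> C i"
    "\<And>i y. i < d \<Longrightarrow> y \<in> span B \<Longrightarrow> \<bar>c i y\<bar> \<le> C i * norm y" by metis
  \<comment> \<open>Leibniz formula for the determinant of the coordinates of
    \<open>y 0, ..., y (d - 1)\<close>. It is linear in each slot (\<open>lin\<close>) and vanishes
    on repeated vectors (\<open>alt\<close>), as Cramer's rule requires.\<close>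
  define \<Delta> where "\<Delta> y = (\<Sum>p | p permutes {..<d}. of_int (sign p) * (\<Prod>i<d. c i (y (p i))))" for y
  have fin: "finite {p. p permutes {..<d}}" by (rule finite_permutations) simp
  have lin: "linear (\<lambda>v. \<Delta> (y(k := v)))" if "k < d" for y k
    unfolding \<Delta>_def
  proof (rule linear_compose_sum, intro ballI)
    fix p assume "p \<in> {p. p permutes {..<d}}"
    then have p: "p permutes {..<d}" by simp
    define j where "j = inv p k"
    have j: "j < d" "p j = k"
      using p that permutes_in_image[OF permutes_inv[OF p], of k] permutes_inverses(1)[OF p]
      by (auto simp: j_def)
    have pj: "p i \<noteq> k" if "i \<noteq> j" for i using permutes_inj[OF p] j(2) that by (auto dest: injD)
    have "(\<Prod>i<d. c i ((y(k := v)) (p i))) = c j v * (\<Prod>i\<in>{..<d} - {j}. c i (y (p i)))" for v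
      using j pj by (subst prod.remove[of _ j]) (auto intro!: prod.cong)
    then show "linear (\<lambda>v. of_int (sign p) * (\<Prod>i<d. c i ((y(k := v)) (p i))))"
      by (auto intro!: linearI simp: linear_add[OF c(1)] linear_scale[OF c(1)] algebra_simps)
  qed
  have alt: "\<Delta> y = 0" if kl: "k < d" "l < d" "k \<noteq> l" "y k = y l" for y k l
  proof -
    let ?t = "Transposition.transpose k l"
    have t: "?t permutes {..<d}" using kl by (intro permutes_swap_id) auto
    have yt: "y (?t i) = y i" for i using kl(4) by (auto simp: Transposition.transpose_def)
    have "\<Delta> y = (\<Sum>p | p permutes {..<d}. of_int (sign (?t \<circ> p)) * (\<Prod>i<d. c i (y ((?t \<circ> p) i))))"
      unfolding \<Delta>_def by (rule setum_permutations_compose_left[OF t])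
    also have "\<dots> = (\<Sum>p | p permutes {..<d}. - (of_int (sign p) * (\<Prod>i<d. c i (y (p i)))))"
    proof (rule sum.cong)
      fix p assume "p \<in> {p. p permutes {..<d}}"
      then have "permutation p" using permutation_permutes by blast
      then have "sign (?t \<circ> p) = - sign p"
        using kl(3) by (simp add: sign_compose permutation_swap_id sign_swap_id)
      then show "of_int (sign (?t \<circ> p)) * (\<Prod>i<d. c i (y ((?t \<circ> p) i))) =
          - (of_int (sign p) * (\<Prod>i<d. c i (y (p i))))" by (simp add: yt)
    qed simp
    also have "\<dots> = - \<Delta> y" by (simp add: \<Delta>_def sum_negf)
    finally show ?thesis by simp
  qed
  define U where "U = {y. \<forall>k<d. y k \<in> span B \<and> norm (y k) \<le> 1}"
  have bdd: "bdd_above ((\<lambda>y. \<bar>\<Delta> y\<bar>) ` U)"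
  proof (rule bdd_aboveI2)
    fix y assume y: "y \<in> U"
    have "\<bar>\<Delta> y\<bar> \<le> (\<Sum>p | p permutes {..<d}. \<bar>of_int (sign p) * (\<Prod>i<d. c i (y (p i)))\<bar>)"
      unfolding \<Delta>_def by (rule sum_abs)
    also have "\<dots> \<le> (\<Sum>p | p permutes {..<d}. (\<Prod>i<d. C i))"
    proof (rule sum_mono)
      fix p assume "p \<in> {p. p permutes {..<d}}"
      then have p: "p permutes {..<d}" by simp
      have "\<bar>of_int (sign p) :: real\<bar> = 1" by (simp add: sign_def)
      then have "\<bar>of_int (sign p) * (\<Prod>i<d. c i (y (p i)))\<bar> = (\<Prod>i<d. \<bar>c i (y (p i))\<bar>)"
        by (simp add: abs_mult abs_prod)
      also have "\<dots> \<le> (\<Prod>i<d. C i)"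
      proof (intro prod_mono conjI)
        fix i assume i: "i \<in> {..<d}"
        then have "p i < d" using permutes_in_image[OF p] by blast
        then have yp: "y (p i) \<in> span B" "norm (y (p i)) \<le> 1" using y by (auto simp: U_def)
        have "\<bar>c i (y (p i))\<bar> \<le> C i * norm (y (p i))" using C(2) i yp by simp
        also have "\<dots> \<le> C i" using C(1)[of i] i yp by (simp add: mult_left_le)
        finally show "\<bar>c i (y (p i))\<bar> \<le> C i" .
      qed simp
      finally show "\<bar>of_int (sign p) * (\<Prod>i<d. c i (y (p i)))\<bar> \<le> (\<Prod>i<d. C i)" .
    qed
    finally show "\<bar>\<Delta> y\<bar> \<le> (\<Sum>p | p permutes {..<d}. (\<Prod>i<d. C i))" .
  qed
  \<comment> \<open>Attainment of the supremum is avoided: a tuple reaching more than half of it is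
    taken, which costs the factor 2 in the bounds.\<close>
  define s where "s = (SUP y\<in>U. \<bar>\<Delta> y\<bar>)"
  have le_s: "\<bar>\<Delta> y\<bar> \<le> s" if "y \<in> U" for y unfolding s_def using bdd that by (rule cSUP_upper2) auto
  define y0 where "y0 k = (1 / norm (e k)) *\<^sub>R e k" for k
  have e0: "e k \<noteq> 0" if "k < d" for k using eB[OF that] B(2) dependent_zero by force
  have y0U: "y0 \<in> U" using span_scale[OF span_base[OF eB]] by (auto simp: U_def y0_def)
  \<comment> \<open>At the normalised basis only the identity permutation contributes, so the
    determinant is a product of positive numbers and \<open>s > 0\<close>.\<close>
  have "\<Delta> y0 = (\<Sum>p\<in>{id}. of_int (sign p) * (\<Prod>i<d. c i (y0 (p i))))"
    unfolding \<Delta>_def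
  proof (rule sum.mono_neutral_right)
    show "{id} \<subseteq> {p. p permutes {..<d}}" by (simp add: permutes_id)
    show "\<forall>p\<in>{p. p permutes {..<d}} - {id}. of_int (sign p) * (\<Prod>i<d. c i (y0 (p i))) = 0"
    proof
      fix p assume p: "p \<in> {p. p permutes {..<d}} - {id}"
      then obtain i where i: "p i \<noteq> i" by (auto simp: fun_eq_iff)
      have "i < d" "p i < d"
        using p i permutes_not_in[of p "{..<d}" i] permutes_in_image[of p "{..<d}" i] by auto
      then have "c i (y0 (p i)) = 0"
        using i by (simp add: y0_def linear_scale[OF c(1)] c(2) eB einj)
      then have "(\<Prod>i<d. c i (y0 (p i))) = 0" using \<open>i < d\<close> by (intro prod_zero) auto
      then show "of_int (sign p) * (\<Prod>i<d. c i (y0 (p i))) = 0" by simp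
    qed
  qed (rule fin)
  also have "\<dots> = (\<Prod>i<d. 1 / norm (e i))"
    by (simp add: y0_def linear_scale[OF c(1)] c(2) eB)
  also have "\<dots> > 0" using e0 by (intro prod_pos) auto
  finally have "s > 0" using le_s[OF y0U] by linarith
  then have "s / 2 < (SUP y\<in>U. \<bar>\<Delta> y\<bar>)" unfolding s_def[symmetric] by simp
  then obtain b where bU: "b \<in> U" and bs: "s / 2 < \<bar>\<Delta> b\<bar>"
    using less_cSUP_iff[OF _ bdd] y0U by blast
  have b: "b k \<in> span B" "norm (b k) \<le> 1" if "k < d" for k using bU that by (auto simp: U_def)
  have D0: "\<Delta> b \<noteq> 0" using bs \<open>s > 0\<close> by auto
  \<comment> \<open>Cramer's rule. Putting a unit vector of \<open>span B\<close> into slot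
    \<open>k\<close> keeps the tuple in \<open>U\<close>, so the numerator is at most
    \<open>s\<close>, which is less than twice the absolute value of
    \<open>\<Delta> b\<close>.\<close>
  define g0 where "g0 k v = \<Delta> (b(k := v)) / \<Delta> b" for k v
  have lin0: "linear (g0 k)" if "k < d" for k
    unfolding g0_def using linear_add[OF lin[OF that, of b]] linear_scale[OF lin[OF that, of b]]
    by (auto intro!: linearI simp: add_divide_distrib)
  have bound0: "\<bar>g0 k v\<bar> \<le> 2 * norm v" if k: "k < d" and v: "v \<in> span B" for k v
  proof (cases "v = 0")
    case True then show ?thesis using linear_0[OF lin0[OF k]] by simp
  next
    case False
    let ?u = "(1 / norm v) *\<^sub>R v"
    have "b(k := ?u) \<in> U" using bU v False by (auto simp: U_def intro: span_scale)
    then have "\<bar>\<Delta> (b(k := ?u))\<bar> \<le> 2 * \<bar>\<Delta> b\<bar>" using le_s bs by fastforce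
    then have "\<bar>g0 k ?u\<bar> \<le> 2" using D0 by (simp add: g0_def field_simps)
    moreover have "g0 k ?u = g0 k v / norm v" using linear_scale[OF lin0[OF k]] by simp
    ultimately show ?thesis using False by (simp add: field_simps)
  qed
  have dual: "g0 k (b l) = (if k = l then 1 else 0)" if "k < d" "l < d" for k l
  proof (cases "k = l")
    case True then show ?thesis using D0 by (simp add: g0_def)
  next
    case False
    then have "\<Delta> (b(k := b l)) = 0" using that by (intro alt[of k l]) auto
    then show ?thesis using False by (simp add: g0_def)
  qed
  \<comment> \<open>The dual system makes the \<open>d\<close> vectors \<open>b k\<close>
    independent; a vector of \<open>span B\<close> outside their span would give
    \<open>d + 1\<close> independent vectors.\<close>
  have spanb: "span B \<subseteq> span (b ` {..<d})"
  proof
    fix v assume v: "v \<in> span B"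
    show "v \<in> span (b ` {..<d})"
    proof (rule ccontr)
      assume nv: "v \<notin> span (b ` {..<d})"
      have injb: "inj_on b {..<d}"
        by (rule inj_onI) (metis dual lessThan_iff zero_neq_one)
      have "independent (b ` {..<d})"
        unfolding dependent_def
      proof (intro notI, elim bexE)
        fix a assume a: "a \<in> b ` {..<d}" "a \<in> span (b ` {..<d} - {a})"
        then obtain l where l: "l < d" "a = b l" by auto
        have "g0 l a = 0"
        proof (rule linear_eq_0_on_span[OF lin0[OF l(1)] _ a(2)])
          show "g0 l x = 0" if "x \<in> b ` {..<d} - {a}" for x using that l dual by auto
        qed
        then show False using dual l by simp
      qed
      then have "independent (insert v (b ` {..<d}))" using nv by (rule independent_insertI[rotated])
      then have "card (insert v (b ` {..<d})) \<le> card B"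
        using independent_span_bound[OF B(1)] v b by blast
      moreover have "v \<notin> b ` {..<d}" using nv span_base[of v "b ` {..<d}"] by blast
      ultimately show False using injb by (simp add: card_image d_def)
    qed
  qed
  have "\<exists>f. linear f \<and> (\<forall>x. \<bar>f x\<bar> \<le> 2 * norm x) \<and> (\<forall>y\<in>span B. f y = g0 k y)" if k: "k < d" for k
    by (rule hahn_banach_subspace[OF subspace_span lin0[OF k] bound0[OF k]]) auto
  then obtain g where g: "\<And>k. k < d \<Longrightarrow> linear (g k)" "\<And>k x. k < d \<Longrightarrow> \<bar>g k x\<bar> \<le> 2 * norm x"
    "\<And>k y. k < d \<Longrightarrow> y \<in> span B \<Longrightarrow> g k y = g0 k y" by metis
  have "(\<Sum>k<d. g k y *\<^sub>R b k) = y" if y: "y \<in> span B" for y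
  proof -
    have "linear (\<lambda>y. (\<Sum>k<d. g k y *\<^sub>R b k) - y)"
      by (auto intro!: linearI simp: linear_add[OF g(1)] linear_scale[OF g(1)] algebra_simps
          sum.distrib scaleR_sum_right)
    then have "(\<Sum>k<d. g k y *\<^sub>R b k) - y = 0"
    proof (rule linear_eq_0_on_span[of _ "b ` {..<d}"])
      fix x assume "x \<in> b ` {..<d}"
      then obtain l where l: "l < d" "x = b l" by auto
      have "(\<Sum>k<d. g k x *\<^sub>R b k) = (\<Sum>k<d. if k = l then b k else 0)"
        using l by (intro sum.cong) (auto simp: g(3) b dual)
      then show "(\<Sum>k<d. g k x *\<^sub>R b k) - x = 0" using l by simp
    qed (use y spanb in blast)
    then show ?thesis by simp
  qed
  then show thesis using that[of b g] b g(1,2) unfolding d_def by blast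
qed

section \<open>Separated sets and nets in finite-dimensional subspaces\<close>

text \<open>Pigeonhole on coordinates rounded to multiples of \<open>1 / m\<close> with
  \<open>m = d + 1\<close>: vectors with equal rounding differ by at most \<open>d / m < 2\<close>
  in norm. The constant is crude, but the growth in \<open>R\<close> is of the right order
  \<open>R ^ d\<close>.\<close>

lemma card_separated_le:
  fixes b :: "nat \<Rightarrow> 'a::real_normed_vector" and g :: "nat \<Rightarrow> 'a \<Rightarrow> real"
  assumes b: "\<And>k. k < d \<Longrightarrow> norm (b k) \<le> 1"
    and g: "\<And>k x. k < d \<Longrightarrow> \<bar>g k x\<bar> \<le> 2 * norm x"
    and rep: "\<And>y. y \<in> E \<Longrightarrow> (\<Sum>k<d. g k y *\<^sub>R b k) = y"
    and S: "finite S" "S \<subseteq> E" "\<And>y. y \<in> S \<Longrightarrow> norm y \<le> R" "1 \<le> R"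
    and sep: "\<And>y z. y \<in> S \<Longrightarrow> z \<in> S \<Longrightarrow> y \<noteq> z \<Longrightarrow> 2 \<le> norm (y - z)"
  shows "real (card S) \<le> ((4 * real d + 7) * R) ^ d"
proof -
  define m where "m = real d + 1"
  define F where "F y = restrict (\<lambda>k. \<lfloor>g k y * m\<rfloor>) {..<d}" for y
  define w where "w = 2 * R * m"
  define K where "K = \<lfloor>w\<rfloor> + 1"
  have m: "m \<ge> 1" by (simp add: m_def)
  have "inj_on F S"
  proof (rule inj_onI, rule ccontr)
    fix y z assume yz: "y \<in> S" "z \<in> S" "F y = F z" "y \<noteq> z"
    have "\<bar>g k y - g k z\<bar> \<le> 1 / m" if "k < d" for k
    proof -
      have "\<lfloor>g k y * m\<rfloor> = \<lfloor>g k z * m\<rfloor>" using fun_cong[OF yz(3), of k] that by (simp add: F_def)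
      then have "\<bar>g k y * m - g k z * m\<bar> \<le> 1" by linarith
      then have "\<bar>(g k y - g k z) * m\<bar> \<le> 1" by (simp add: left_diff_distrib)
      then have "\<bar>g k y - g k z\<bar> * m \<le> 1" using m by (simp add: abs_mult)
      then show ?thesis using m by (simp add: field_simps)
    qed
    then have "norm ((g k y - g k z) *\<^sub>R b k) \<le> 1 / m" if "k < d" for k
      using mult_mono[of "\<bar>g k y - g k z\<bar>" "1 / m" "norm (b k)" 1] b that m by simp
    then have "norm (\<Sum>k<d. (g k y - g k z) *\<^sub>R b k) \<le> (\<Sum>k<d. 1 / m)"
      by (intro sum_norm_le) simp
    also have "(\<Sum>k<d. (g k y - g k z) *\<^sub>R b k) = y - z"
      using subsetD[OF S(2)] yz(1,2) by (simp add: scaleR_diff_left sum_subtractf rep)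
    also have "(\<Sum>k<d. 1 / m) < 2" by (simp add: m_def field_simps)
    finally show False using sep yz by fastforce
  qed
  moreover have "F ` S \<subseteq> PiE {..<d} (\<lambda>_. {-K..K})"
  proof
    fix u assume "u \<in> F ` S"
    then obtain y where y: "y \<in> S" "u = F y" by blast
    have "\<lfloor>g k y * m\<rfloor> \<in> {-K..K}" if "k < d" for k
    proof -
      have "\<bar>g k y * m\<bar> \<le> w" unfolding w_def
        using g[OF that, of y] S(3)[OF y(1)] m by (auto simp: abs_mult intro!: mult_right_mono)
      then show ?thesis unfolding K_def by (auto simp: abs_le_iff) linarith+
    qed
    then show "u \<in> PiE {..<d} (\<lambda>_. {-K..K})" using y by (auto simp: F_def)
  qed
  ultimately have "card S \<le> card (PiE {..<d} (\<lambda>_. {-K..K}))"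
    by (intro card_inj_on_le[of F]) (auto intro: finite_PiE)
  also have "\<dots> = nat (2 * K + 1) ^ d" by (simp add: card_PiE add.commute)
  finally have "real (card S) \<le> real (nat (2 * K + 1)) ^ d" by (metis of_nat_le_iff of_nat_power)
  also have "\<dots> \<le> ((4 * real d + 7) * R) ^ d"
  proof (rule power_mono)
    have "0 \<le> w" using S(4) m by (simp add: w_def)
    then have "K \<ge> 0" by (simp add: K_def)
    then have "real (nat (2 * K + 1)) = 2 * real_of_int K + 1" by simp
    also have "\<dots> \<le> 2 * (w + 1) + 1" using of_int_floor_le[of w] by (simp add: K_def)
    also have "\<dots> \<le> 4 * R * m + 3 * R" using S(4) by (simp add: w_def)
    also have "\<dots> = (4 * real d + 7) * R" by (simp add: m_def algebra_simps)
    finally show "real (nat (2 * K + 1)) \<le> (4 * real d + 7) * R" .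
  qed simp
  finally show ?thesis .
qed

text \<open>The usual volume bound, obtained by a power trick: nesting blown-up copies of
  \<open>S\<close> gives \<open>card S ^ n\<close> points, 2-separated and of norm at most
  \<open>\<mu> ^ n - 1\<close>. The factor \<open>(4 * d + 7) ^ d\<close> from
  \<open>card_separated_le\<close> does not grow with \<open>n\<close>, so it disappears when
  exponential growth rates are compared.\<close>

lemma card_packing_le:
  fixes b :: "nat \<Rightarrow> 'a::real_normed_vector" and g :: "nat \<Rightarrow> 'a \<Rightarrow> real"
  assumes b: "\<And>k. k < d \<Longrightarrow> norm (b k) \<le> 1"
    and g: "\<And>k x. k < d \<Longrightarrow> \<bar>g k x\<bar> \<le> 2 * norm x"
    and rep: "\<And>y. y \<in> E \<Longrightarrow> (\<Sum>k<d. g k y *\<^sub>R b k) = y"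
    and E: "subspace E" and \<epsilon>: "0 < \<epsilon>"
    and S: "finite S" "S \<subseteq> E" "\<And>y. y \<in> S \<Longrightarrow> norm y \<le> 1"
    and sep: "\<And>y z. y \<in> S \<Longrightarrow> z \<in> S \<Longrightarrow> y \<noteq> z \<Longrightarrow> \<epsilon> \<le> norm (y - z)"
  shows "real (card S) \<le> (1 + 2 / \<epsilon>) ^ d"
proof -
  define \<mu> where "\<mu> = 1 + 2 / \<epsilon>"
  have \<mu>: "\<mu> \<ge> 1" using \<epsilon> by (simp add: \<mu>_def)
  \<comment> \<open>Iterating the packing \<open>n\<close> times removes the constant from the crude bound.\<close>
  have pack: "\<exists>T. finite T \<and> card T = card S ^ n \<and> T \<subseteq> E \<and> (\<forall>y\<in>T. norm y \<le> \<mu> ^ n - 1) \<and>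
      (\<forall>y\<in>T. \<forall>z\<in>T. y \<noteq> z \<longrightarrow> 2 \<le> norm (y - z))" for n
  proof (induction n)
    case 0
    show ?case by (rule exI[of _ "{0}"]) (use subspace_0[OF E] in auto)
  next
    case (Suc n)
    then obtain T where T: "finite T" "card T = card S ^ n" "T \<subseteq> E" "\<forall>y\<in>T. norm y \<le> \<mu> ^ n - 1"
      "\<forall>y\<in>T. \<forall>z\<in>T. y \<noteq> z \<longrightarrow> 2 \<le> norm (y - z)" by (elim exE conjE) (rule that)
    \<comment> \<open>Scaled by \<open>a\<close>, distinct points of \<open>S\<close> are at least
      \<open>2 * \<mu> ^ n\<close> apart. This leaves a gap of 2 between translates of
      \<open>T\<close>, and the radii add up to \<open>\<mu> ^ Suc n - 1\<close>.\<close>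
    define a where "a = \<mu> ^ n * (2 / \<epsilon>)"
    have a: "a \<ge> 0" "a * \<epsilon> = 2 * \<mu> ^ n" using \<mu> \<epsilon> by (auto simp: a_def)
    define h where "h p = a *\<^sub>R fst p + snd p" for p :: "'a \<times> 'a"
    have far: "2 \<le> norm (h p - h q)" if "p \<in> S \<times> T" "q \<in> S \<times> T" "p \<noteq> q" for p q
    proof (cases "fst p = fst q")
      case True
      then have "snd p \<noteq> snd q" using that(3) by (simp add: prod_eq_iff)
      then have "2 \<le> norm (snd p - snd q)" using that by (intro T(5)[rule_format]) auto
      then show ?thesis using True by (simp add: h_def)
    next
      case False
      have "2 * \<mu> ^ n \<le> a * norm (fst p - fst q)"
        unfolding a(2)[symmetric] using that False a by (intro mult_left_mono sep) auto
      also have "\<dots> = norm ((h p - h q) - (snd p - snd q))"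
        using a norm_scaleR[of a "fst p - fst q"] by (simp add: h_def algebra_simps)
      also have "\<dots> \<le> norm (h p - h q) + (norm (snd p) + norm (snd q))"
        using norm_triangle_ineq4[of "h p - h q" "snd p - snd q"] norm_triangle_ineq4[of "snd p" "snd q"]
        by linarith
      also have "\<dots> \<le> norm (h p - h q) + ((\<mu> ^ n - 1) + (\<mu> ^ n - 1))"
        using that by (intro add_mono T(4)[rule_format]) auto
      finally show ?thesis by simp
    qed
    have "inj_on h (S \<times> T)"
    proof (rule inj_onI, rule ccontr)
      fix p q assume "p \<in> S \<times> T" "q \<in> S \<times> T" "h p = h q" "p \<noteq> q"
      with far[of p q] show False by simp
    qed
    then have "card (h ` (S \<times> T)) = card S ^ Suc n" by (simp add: card_image card_cartesian_product T(2))
    moreover have "h ` (S \<times> T) \<subseteq> E"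
      using S(2) T(3) by (auto simp: h_def intro!: subspace_add[OF E] subspace_scale[OF E])
    moreover have "norm (h p) \<le> \<mu> ^ Suc n - 1" if "p \<in> S \<times> T" for p
    proof -
      have "norm (h p) \<le> a * norm (fst p) + norm (snd p)"
        unfolding h_def using norm_triangle_ineq[of "a *\<^sub>R fst p" "snd p"] a by simp
      also have "\<dots> \<le> a * 1 + (\<mu> ^ n - 1)"
        using that a by (intro add_mono mult_left_mono S(3) T(4)[rule_format]) auto
      also have "\<dots> = \<mu> ^ Suc n - 1" by (simp add: a_def \<mu>_def algebra_simps)
      finally show ?thesis .
    qed
    moreover have "finite (h ` (S \<times> T))" using S(1) T(1) by simp
    moreover have "2 \<le> norm (y - z)" if "y \<in> h ` (S \<times> T)" "z \<in> h ` (S \<times> T)" "y \<noteq> z" for y z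
      using that far by (elim imageE) metis
    ultimately show ?case by (intro exI[of _ "h ` (S \<times> T)"] conjI ballI impI) blast+
  qed
  have le: "real (card S) ^ n \<le> (4 * real d + 7) ^ d * (\<mu> ^ d) ^ n" for n
  proof -
    obtain T where T: "finite T" "card T = card S ^ n" "T \<subseteq> E" "\<forall>y\<in>T. norm y \<le> \<mu> ^ n - 1"
      "\<forall>y\<in>T. \<forall>z\<in>T. y \<noteq> z \<longrightarrow> 2 \<le> norm (y - z)"
      using pack[of n] by (elim exE conjE) (rule that)
    have "real (card T) \<le> ((4 * real d + 7) * \<mu> ^ n) ^ d"
    proof (rule card_separated_le[OF b g rep T(1,3)])
      show "norm y \<le> \<mu> ^ n" if "y \<in> T" for y using T(4) that by fastforce
      show "1 \<le> \<mu> ^ n" using \<mu> by simp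
      show "2 \<le> norm (y - z)" if "y \<in> T" "z \<in> T" "y \<noteq> z" for y z using T(5) that by blast
    qed
    then show ?thesis by (simp add: T(2) power_mult_distrib mult.commute flip: power_mult)
  qed
  have "real (card S) \<le> \<mu> ^ d"
  proof (rule ccontr)
    assume "\<not> real (card S) \<le> \<mu> ^ d"
    then have gt: "1 < real (card S) / \<mu> ^ d" using \<mu> by (simp add: field_simps)
    obtain n where "(4 * real d + 7) ^ d < (real (card S) / \<mu> ^ d) ^ n"
      using real_arch_pow[OF gt] by blast
    then show False using le[of n] \<mu> by (simp add: power_divide field_simps)
  qed
  then show ?thesis by (simp add: \<mu>_def)
qed

text \<open>A separated subset of the unit sphere of \<open>E\<close> with the most elements is a
  net; the packing bound guarantees that a maximum exists.\<close>

lemma finite_net_exists: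
  fixes b :: "nat \<Rightarrow> 'a::real_normed_vector" and g :: "nat \<Rightarrow> 'a \<Rightarrow> real"
  assumes b: "\<And>k. k < d \<Longrightarrow> norm (b k) \<le> 1"
    and g: "\<And>k x. k < d \<Longrightarrow> \<bar>g k x\<bar> \<le> 2 * norm x"
    and rep: "\<And>y. y \<in> E \<Longrightarrow> (\<Sum>k<d. g k y *\<^sub>R b k) = y"
    and E: "subspace E" and \<epsilon>: "0 < \<epsilon>"
  obtains S where "finite S" "S \<subseteq> E" "\<And>z. z \<in> S \<Longrightarrow> norm z = 1" "real (card S) \<le> (1 + 2 / \<epsilon>) ^ d"
    "\<And>y. y \<in> E \<Longrightarrow> norm y = 1 \<Longrightarrow> \<exists>z\<in>S. norm (y - z) < \<epsilon>"
proof -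
  define P where "P S \<longleftrightarrow> finite S \<and> S \<subseteq> E \<and> (\<forall>z\<in>S. norm z = 1) \<and>
    (\<forall>y\<in>S. \<forall>z\<in>S. y \<noteq> z \<longrightarrow> \<epsilon> \<le> norm (y - z))" for S
  have bound: "real (card S) \<le> (1 + 2 / \<epsilon>) ^ d" if "P S" for S
    using that by (intro card_packing_le[OF b g rep E \<epsilon>]) (auto simp: P_def)
  obtain N :: nat where "(1 + 2 / \<epsilon>) ^ d < N" using reals_Archimedean2 by blast
  then have "\<forall>S. P S \<longrightarrow> card S < N" using bound by fastforce
  moreover have "P {}" by (simp add: P_def)
  ultimately obtain S where S: "P S" and max: "\<And>S'. P S' \<Longrightarrow> card S' \<le> card S"
    using ex_has_greatest_nat[of P "{}" card N] by blast
  have "\<exists>z\<in>S. norm (y - z) < \<epsilon>" if y: "y \<in> E" "norm y = 1" for y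
  proof (rule ccontr)
    assume "\<not> ?thesis"
    then have far: "\<epsilon> \<le> norm (y - z)" "\<epsilon> \<le> norm (z - y)" if "z \<in> S" for z
      using that by (auto simp: norm_minus_commute not_less)
    then have "y \<notin> S" using \<epsilon> by force
    have "P (insert y S)" using S y far by (auto simp: P_def)
    from max[OF this] show False using \<open>y \<notin> S\<close> S by (simp add: P_def)
  qed
  then show thesis using that[of S] S bound[OF S] by (auto simp: P_def)
qed

section \<open>Averages along segments and directional derivatives\<close>

text \<open>The direction is the first argument, so that \<open>foldr avg zs f\<close> averages
  \<open>f\<close> over the parallelepiped spanned by the list \<open>zs\<close>.\<close>

definition avg :: "'a::real_normed_vector \<Rightarrow> ('a \<Rightarrow> 'b::banach) \<Rightarrow> 'a \<Rightarrow> 'b" where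
  "avg z f x = integral {0..1} (\<lambda>t. f (x + t *\<^sub>R z))"

lemma avg_integrable:
  fixes f :: "'a::real_normed_vector \<Rightarrow> 'b::banach"
  assumes "continuous_on UNIV f"
  shows "(\<lambda>t. f (x + t *\<^sub>R z)) integrable_on {a..b::real}"
  by (intro integrable_continuous_interval continuous_on_compose2[OF assms] continuous_intros) auto

lemma avg_norm_le:
  fixes f :: "'a::real_normed_vector \<Rightarrow> 'b::banach"
  assumes "continuous_on UNIV f" "\<And>t. 0 \<le> t \<Longrightarrow> t \<le> 1 \<Longrightarrow> norm (f (x + t *\<^sub>R z)) \<le> B"
  shows "norm (avg z f x) \<le> B"
proof -
  have "norm (integral {0..1} (\<lambda>t. f (x + t *\<^sub>R z))) \<le> B * (1 - 0)"
    using assms(2) by (intro integral_bound continuous_on_compose2[OF assms(1)] continuous_intros) auto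
  then show ?thesis by (simp add: avg_def)
qed

lemma avg_diff:
  fixes f g :: "'a::real_normed_vector \<Rightarrow> 'b::banach"
  assumes "continuous_on UNIV f" "continuous_on UNIV g"
  shows "avg z (\<lambda>x. f x - g x) x = avg z f x - avg z g x"
  unfolding avg_def by (intro integral_diff avg_integrable assms)

lemma avg_scaleR:
  fixes f :: "'a::real_normed_vector \<Rightarrow> 'b::banach"
  shows "avg z (\<lambda>x. c *\<^sub>R f x) x = c *\<^sub>R avg z f x"
  unfolding avg_def by (rule integral_cmul)

lemma avg_translate: "avg z (\<lambda>x. f (x + w)) x = avg z f (x + w)"
  unfolding avg_def by (simp add: algebra_simps)

lemma avg_bounded_linear:
  fixes f :: "'a::real_normed_vector \<Rightarrow> 'b::banach" and V :: "'b \<Rightarrow> 'c::banach"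
  assumes "continuous_on UNIV f" "bounded_linear V"
  shows "avg z (\<lambda>x. V (f x)) x = V (avg z f x)"
  using integral_linear[OF avg_integrable[OF assms(1)] assms(2)] by (simp add: avg_def o_def)

lemma avg_lipschitz:
  fixes f :: "'a::real_normed_vector \<Rightarrow> 'b::banach"
  assumes "L-lipschitz_on UNIV f"
  shows "L-lipschitz_on UNIV (avg z f)"
proof (rule lipschitz_onI)
  have c: "continuous_on UNIV f" by (rule lipschitz_on_continuous_on[OF assms])
  fix x y
  have "norm (avg z (\<lambda>u. f (u + (x - y)) - f u) y) \<le> L * dist x y"
    using c lipschitz_onD[OF assms, of "y + t *\<^sub>R z + (x - y)" "y + t *\<^sub>R z" for t]
    by (intro avg_norm_le continuous_intros continuous_on_compose2[OF c])
       (auto simp: dist_norm algebra_simps)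
  also have "avg z (\<lambda>u. f (u + (x - y)) - f u) y = avg z f x - avg z f y"
    using c by (subst avg_diff) (auto simp: avg_translate intro!: continuous_intros continuous_on_compose2[OF c])
  finally show "dist (avg z f x) (avg z f y) \<le> L * dist x y" by (simp add: dist_norm)
qed (rule lipschitz_on_nonneg[OF assms])

text \<open>The remainder is uniform in the base point, so that it survives averaging.\<close>

definition has_dirderiv ::
  "('a::real_normed_vector \<Rightarrow> 'b::real_normed_vector) \<Rightarrow> 'a \<Rightarrow> ('a \<Rightarrow> 'b) \<Rightarrow> bool" where
  "has_dirderiv f z D \<longleftrightarrow>
     (\<exists>B. \<forall>x c. norm (f (x + c *\<^sub>R z) - f x - c *\<^sub>R D x) \<le> B * c\<^sup>2) \<and> (\<exists>B. B-lipschitz_on UNIV D)"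

lemma has_dirderiv_unique:
  assumes "has_dirderiv f z D" "has_dirderiv f z D'"
  shows "D x = D' x"
proof (rule ccontr)
  assume ne: "D x \<noteq> D' x"
  obtain B B' where B: "\<And>c. norm (f (x + c *\<^sub>R z) - f x - c *\<^sub>R D x) \<le> B * c\<^sup>2"
    "\<And>c. norm (f (x + c *\<^sub>R z) - f x - c *\<^sub>R D' x) \<le> B' * c\<^sup>2"
    using assms unfolding has_dirderiv_def by blast
  have le: "norm (D x - D' x) \<le> (B + B') * c" if "c > 0" for c
  proof -
    have "c * norm (D x - D' x) = norm ((f (x + c *\<^sub>R z) - f x - c *\<^sub>R D' x) - (f (x + c *\<^sub>R z) - f x - c *\<^sub>R D x))"
      using that norm_scaleR[of c "D x - D' x"] by (simp add: scaleR_diff_right)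
    also have "\<dots> \<le> B' * c\<^sup>2 + B * c\<^sup>2"
      by (intro order_trans[OF norm_triangle_ineq4] add_mono B)
    also have "\<dots> = c * ((B + B') * c)" by (simp add: algebra_simps power2_eq_square)
    finally show ?thesis using that by simp
  qed
  have pos: "norm (D x - D' x) > 0" using ne by simp
  then have "B + B' > 0" using le[of 1, simplified] by linarith
  then obtain q where "q = B + B'" "q > 0" by blast
  \<comment> \<open>This \<open>c\<close> would bound the positive number
    \<open>norm (D x - D' x)\<close> by its half.\<close>
  then show False using le[of "norm (D x - D' x) / (2 * q)"] pos by (simp flip: \<open>q = B + B'\<close>)
qed

lemma has_dirderiv_scaleR:
  assumes "has_dirderiv f z D"
  shows "has_dirderiv f (a *\<^sub>R z) (\<lambda>x. a *\<^sub>R D x)"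
proof -
  obtain B where B: "\<And>x c. norm (f (x + c *\<^sub>R z) - f x - c *\<^sub>R D x) \<le> B * c\<^sup>2"
    using assms unfolding has_dirderiv_def by blast
  have "norm (f (x + c *\<^sub>R a *\<^sub>R z) - f x - c *\<^sub>R a *\<^sub>R D x) \<le> (B * a\<^sup>2) * c\<^sup>2" for x c
    using B[of x "c * a"] by (simp add: power_mult_distrib mult_ac)
  moreover obtain K where "K-lipschitz_on UNIV D" using assms unfolding has_dirderiv_def by blast
  then have "(\<bar>a\<bar> * K)-lipschitz_on UNIV (\<lambda>x. a *\<^sub>R D x)"
    by (rule lipschitz_on_cmult)
  ultimately show ?thesis unfolding has_dirderiv_def by blast
qed

text \<open>The increment is split at \<open>x + c *\<^sub>R z\<close>. There \<open>D'\<close>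
  differs from \<open>D' x\<close> by order \<open>c\<close>, by the Lipschitz condition in
  \<open>has_dirderiv\<close>, so the replacement costs only order \<open>c\<^sup>2\<close>.\<close>

lemma has_dirderiv_add:
  assumes "has_dirderiv f z D" "has_dirderiv f w D'"
  shows "has_dirderiv f (z + w) (\<lambda>x. D x + D' x)"
proof -
  obtain B where B: "\<And>x c. norm (f (x + c *\<^sub>R z) - f x - c *\<^sub>R D x) \<le> B * c\<^sup>2"
    using assms unfolding has_dirderiv_def by blast
  obtain B' where B': "\<And>x c. norm (f (x + c *\<^sub>R w) - f x - c *\<^sub>R D' x) \<le> B' * c\<^sup>2"
    using assms unfolding has_dirderiv_def by blast
  obtain K where K: "K-lipschitz_on UNIV D" using assms unfolding has_dirderiv_def by blast
  obtain K' where K': "K'-lipschitz_on UNIV D'" using assms unfolding has_dirderiv_def by blast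
  have "norm (f (x + c *\<^sub>R (z + w)) - f x - c *\<^sub>R (D x + D' x)) \<le> (B + B' + K' * norm z) * c\<^sup>2" for x c
  proof -
    let ?y = "x + c *\<^sub>R z"
    have "f (x + c *\<^sub>R (z + w)) - f x - c *\<^sub>R (D x + D' x) =
        (f ?y - f x - c *\<^sub>R D x) + ((f (?y + c *\<^sub>R w) - f ?y - c *\<^sub>R D' ?y) + c *\<^sub>R (D' ?y - D' x))"
      by (simp add: algebra_simps)
    also have "norm \<dots> \<le> B * c\<^sup>2 + (B' * c\<^sup>2 + K' * norm z * c\<^sup>2)"
    proof (intro order_trans[OF norm_triangle_ineq] add_mono B B')
      have "norm (D' ?y - D' x) \<le> K' * (\<bar>c\<bar> * norm z)"
        using lipschitz_onD[OF K', of ?y x] by (simp add: dist_norm)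
      then have "\<bar>c\<bar> * norm (D' ?y - D' x) \<le> \<bar>c\<bar> * (K' * (\<bar>c\<bar> * norm z))"
        by (rule mult_left_mono) simp
      also have "\<dots> = K' * norm z * (\<bar>c\<bar> * \<bar>c\<bar>)" by simp
      finally show "norm (c *\<^sub>R (D' ?y - D' x)) \<le> K' * norm z * c\<^sup>2"
        by (simp add: power2_eq_square)
    qed
    finally show ?thesis by (simp add: algebra_simps)
  qed
  moreover have "(K + K')-lipschitz_on UNIV (\<lambda>x. D x + D' x)"
    by (rule lipschitz_on_add[OF K K'])
  ultimately show ?thesis unfolding has_dirderiv_def by blast
qed

lemma has_dirderiv_sum:
  assumes "finite I" "\<And>i. i \<in> I \<Longrightarrow> has_dirderiv f (z i) (D i)"
  shows "has_dirderiv f (\<Sum>i\<in>I. z i) (\<lambda>x. \<Sum>i\<in>I. D i x)"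
  using assms
proof (induction I rule: finite_induct)
  case empty
  have "0-lipschitz_on UNIV (\<lambda>x. 0)" by (auto intro!: lipschitz_onI)
  then show ?case by (auto simp: has_dirderiv_def intro!: exI[of _ 0])
qed (auto intro!: has_dirderiv_add)

lemma has_dirderiv_avg:
  fixes f :: "'a::real_normed_vector \<Rightarrow> 'b::banach"
  assumes f: "has_dirderiv f z D" and c: "continuous_on UNIV f"
  shows "has_dirderiv (avg w f) z (avg w D)"
proof -
  obtain B where B: "\<And>x c. norm (f (x + c *\<^sub>R z) - f x - c *\<^sub>R D x) \<le> B * c\<^sup>2"
    using assms unfolding has_dirderiv_def by blast
  obtain K where K: "K-lipschitz_on UNIV D" using assms unfolding has_dirderiv_def by blast
  have cD: "continuous_on UNIV D" by (rule lipschitz_on_continuous_on[OF K])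
  have ct: "continuous_on UNIV (\<lambda>x. f (x + c *\<^sub>R z))" for c
    by (intro continuous_on_compose2[OF c] continuous_intros) auto
  have "norm (avg w f (x + c *\<^sub>R z) - avg w f x - c *\<^sub>R avg w D x) \<le> B * c\<^sup>2" for x c
  proof -
    have "avg w f (x + c *\<^sub>R z) - avg w f x - c *\<^sub>R avg w D x =
        avg w (\<lambda>x. f (x + c *\<^sub>R z) - f x - c *\<^sub>R D x) x"
      using c ct cD by (simp add: avg_diff avg_scaleR avg_translate continuous_intros)
    also have "norm \<dots> \<le> B * c\<^sup>2"
      using c ct cD by (intro avg_norm_le B continuous_intros)
    finally show ?thesis .
  qed
  then show ?thesis using avg_lipschitz[OF K] unfolding has_dirderiv_def by blast
qed

text \<open>Averaging makes a merely Lipschitz map differentiable along \<open>z\<close>: shifting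
  the segment by \<open>c *\<^sub>R z\<close> adds a short piece at one end and removes one at the
  other, and on each piece \<open>f\<close> is nearly constant.\<close>

lemma has_dirderiv_avg_self:
  fixes f :: "'a::real_normed_vector \<Rightarrow> 'b::banach"
  assumes f: "L-lipschitz_on UNIV f"
  shows "has_dirderiv (avg z f) z (\<lambda>x. f (x + z) - f x)"
proof -
  have c: "continuous_on UNIV f" by (rule lipschitz_on_continuous_on[OF f])
  have L: "0 \<le> L" by (rule lipschitz_on_nonneg[OF f])
  have "norm (avg z f (x + c *\<^sub>R z) - avg z f x - c *\<^sub>R (f (x + z) - f x)) \<le> (2 * L * norm z) * c\<^sup>2" for x c
  proof -
    define g where "g t = f (x + t *\<^sub>R z)" for t
    have gc: "continuous_on S g" for S unfolding g_def
      by (intro continuous_on_compose2[OF c] continuous_intros) auto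
    have gi: "g integrable_on {a..b}" for a b by (intro integrable_continuous_interval gc)
    \<comment> \<open>Oriented integral, so that the endpoint computation is uniform in the sign of
      \<open>c\<close>.\<close>
    define I where "I u v = (if u \<le> v then integral {u..v} g else - integral {v..u} g)" for u v
    have split: "I u v + I v w = I u w" for u v w
      using Henstock_Kurzweil_Integration.integral_combine[of u v w g]
        Henstock_Kurzweil_Integration.integral_combine[of u w v g]
        Henstock_Kurzweil_Integration.integral_combine[of v u w g]
        Henstock_Kurzweil_Integration.integral_combine[of v w u g]
        Henstock_Kurzweil_Integration.integral_combine[of w u v g]
        Henstock_Kurzweil_Integration.integral_combine[of w v u g] gi
      by (auto simp: I_def algebra_simps)
    have "avg z f (x + c *\<^sub>R z) = integral {0..1} (\<lambda>t. g (t + c))"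
      by (simp add: avg_def g_def algebra_simps)
    also have "\<dots> = integral {c..1 + c} g"
      using integral_shift_real_ivl[of c c "1 + c" g] by simp
    finally have 1: "avg z f (x + c *\<^sub>R z) = I c (1 + c)" by (simp add: I_def)
    have 2: "avg z f x = I 0 1" by (simp add: I_def avg_def g_def[abs_def])
    have est0: "norm (integral {a..b} g - (b - a) *\<^sub>R g u) \<le> L * norm z * c\<^sup>2"
      if "a \<le> b" "b - a = \<bar>c\<bar>" "a \<le> u" "u \<le> b" for a b u
    proof -
      have "integral {a..b} (\<lambda>t. g t - g u) = integral {a..b} g - (b - a) *\<^sub>R g u"
        using that by (subst integral_diff) (auto intro: gi)
      moreover have "norm (integral {a..b} (\<lambda>t. g t - g u)) \<le> (L * (\<bar>c\<bar> * norm z)) * (b - a)"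
      proof (rule integral_bound)
        show "continuous_on {a..b} (\<lambda>t. g t - g u)" by (intro continuous_intros gc)
        fix t assume "t \<in> {a..b}"
        then have "\<bar>t - u\<bar> \<le> \<bar>c\<bar>" using that by auto
        have "norm (g t - g u) \<le> L * (\<bar>t - u\<bar> * norm z)"
          using lipschitz_onD[OF f, of "x + t *\<^sub>R z" "x + u *\<^sub>R z"]
          by (simp add: g_def dist_norm flip: scaleR_diff_left)
        also have "\<dots> \<le> L * (\<bar>c\<bar> * norm z)"
          using L \<open>\<bar>t - u\<bar> \<le> \<bar>c\<bar>\<close> by (intro mult_left_mono mult_right_mono) auto
        finally show "norm (g t - g u) \<le> L * (\<bar>c\<bar> * norm z)" .
      qed (fact that)
      moreover have "(L * (\<bar>c\<bar> * norm z)) * (b - a) = L * norm z * c\<^sup>2"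
        unfolding that(2) by (simp add: power2_eq_square)
      ultimately show ?thesis by simp
    qed
    have est: "norm (I u (u + c) - c *\<^sub>R g u) \<le> L * norm z * c\<^sup>2" for u
    proof (cases "0 \<le> c")
      case True then show ?thesis using est0[of u "u + c" u] by (simp add: I_def)
    next
      case False
      then have "I u (u + c) - c *\<^sub>R g u = - (integral {u + c..u} g - (u - (u + c)) *\<^sub>R g u)"
        by (simp add: I_def)
      then show ?thesis using False est0[of "u + c" u u] by (simp only: norm_minus_cancel) simp
    qed
    have "avg z f (x + c *\<^sub>R z) - avg z f x - c *\<^sub>R (f (x + z) - f x) =
      (I 1 (1 + c) - c *\<^sub>R g 1) - (I 0 (0 + c) - c *\<^sub>R g 0)"
      using split[of 0 c "1 + c"] split[of 0 1 "1 + c"]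
      by (simp add: 1 2 g_def algebra_simps) 
    also have "norm \<dots> \<le> L * norm z * c\<^sup>2 + L * norm z * c\<^sup>2"
      by (intro order_trans[OF norm_triangle_ineq4] add_mono est)
    finally show ?thesis by simp
  qed
  moreover have "(L + L)-lipschitz_on UNIV (\<lambda>x. f (x + z) - f x)"
    using lipschitz_onD[OF f, of "x + z" "y + z" for x y]
    by (intro lipschitz_on_diff f lipschitz_onI) (auto simp: L)
  ultimately show ?thesis unfolding has_dirderiv_def by blast
qed

section \<open>Iterated averages over parallelepipeds\<close>

lemma avgs_lipschitz:
  fixes f :: "'a::real_normed_vector \<Rightarrow> 'b::banach"
  assumes "L-lipschitz_on UNIV f"
  shows "L-lipschitz_on UNIV (foldr avg zs f)"
  by (induction zs) (auto intro: assms avg_lipschitz)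

text \<open>Differentiating along \<open>z\<close> turns one average in that direction into a
  difference of endpoint values, hence \<open>remove1\<close>; the other averages commute with this
  and survive.\<close>

lemma has_dirderiv_avgs:
  fixes f :: "'a::real_normed_vector \<Rightarrow> 'b::banach"
  assumes f: "L-lipschitz_on UNIV f" and "z \<in> set zs"
  shows "has_dirderiv (foldr avg zs f) z
    (\<lambda>x. foldr avg (remove1 z zs) f (x + z) - foldr avg (remove1 z zs) f x)"
  using assms(2)
proof (induction zs)
  case (Cons w zs)
  show ?case
  proof (cases "z = w")
    case True then show ?thesis using has_dirderiv_avg_self[OF avgs_lipschitz[OF f]] by simp
  next
    case False
    let ?g = "foldr avg (remove1 z zs) f"
    have g: "continuous_on UNIV ?g" by (rule lipschitz_on_continuous_on[OF avgs_lipschitz[OF f]])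
    have g': "continuous_on UNIV (\<lambda>x. ?g (x + z))"
      by (intro continuous_on_compose2[OF g] continuous_intros) auto
    have "has_dirderiv (avg w (foldr avg zs f)) z (avg w (\<lambda>x. ?g (x + z) - ?g x))"
      using Cons False by (intro has_dirderiv_avg lipschitz_on_continuous_on[OF avgs_lipschitz[OF f]]) auto
    moreover have "avg w (\<lambda>x. ?g (x + z) - ?g x) = (\<lambda>x. avg w ?g (x + z) - avg w ?g x)"
      by (rule ext) (simp add: avg_diff[OF g' g] avg_translate)
    ultimately show ?thesis using False by simp
  qed
qed simp

lemma avgs_bounded_linear:
  fixes f :: "'a::real_normed_vector \<Rightarrow> 'b::banach" and V :: "'b \<Rightarrow> 'c::banach"
  assumes f: "L-lipschitz_on UNIV f" and V: "bounded_linear V"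
  shows "foldr avg zs (\<lambda>x. V (f x)) = (\<lambda>x. V (foldr avg zs f x))"
  by (induction zs)
    (simp_all add: avg_bounded_linear[OF lipschitz_on_continuous_on[OF avgs_lipschitz[OF f]] V])

lemma avgs_diff:
  fixes f g :: "'a::real_normed_vector \<Rightarrow> 'b::banach"
  assumes "L-lipschitz_on UNIV f" "L'-lipschitz_on UNIV g"
  shows "foldr avg zs (\<lambda>x. f x - g x) = (\<lambda>x. foldr avg zs f x - foldr avg zs g x)"
  by (induction zs)
    (auto intro!: ext avg_diff[OF lipschitz_on_continuous_on lipschitz_on_continuous_on] avgs_lipschitz[OF assms(1)] avgs_lipschitz[OF assms(2)])

fun cube :: "'a::real_normed_vector list \<Rightarrow> 'a set" where
  "cube [] = {0}"
| "cube (z # zs) = {t *\<^sub>R z + w | t w. 0 \<le> t \<and> t \<le> 1 \<and> w \<in> cube zs}"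

lemma cube_norm_le: "w \<in> cube zs \<Longrightarrow> norm w \<le> (\<Sum>z\<leftarrow>zs. norm z)"
proof (induction zs arbitrary: w)
  case (Cons z zs)
  then obtain t v where t: "0 \<le> t" "t \<le> 1" "v \<in> cube zs" and w: "w = t *\<^sub>R z + v" by auto
  have "norm w \<le> norm (t *\<^sub>R z) + norm v" unfolding w by (rule norm_triangle_ineq)
  also have "\<dots> \<le> norm z + (\<Sum>z\<leftarrow>zs. norm z)"
    using t by (intro add_mono Cons.IH) (auto intro: mult_left_le_one_le)
  finally show ?case by simp
qed simp

lemma cube_subset_span: "cube zs \<subseteq> span (set zs)"
proof (induction zs)
  case (Cons z zs)
  have "span (set zs) \<subseteq> span (set (z # zs))" by (intro span_mono) auto
  with Cons show ?case by (auto intro!: span_add span_scale intro: span_base)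
qed simp

lemma cube_append: "w \<in> cube (xs @ ys) \<Longrightarrow> \<exists>u\<in>cube xs. \<exists>v\<in>cube ys. w = u + v"
proof (induction xs arbitrary: w)
  case (Cons x xs)
  then obtain t w' where t: "0 \<le> t" "t \<le> 1" "w' \<in> cube (xs @ ys)" and w: "w = t *\<^sub>R x + w'" by auto
  then obtain u v where "u \<in> cube xs" "v \<in> cube ys" "w' = u + v" using Cons.IH by blast
  then show ?case using t w by (intro bexI[of _ "t *\<^sub>R x + u"] bexI[of _ v]) auto
qed simp

lemma avgs_norm_le:
  fixes f :: "'a::real_normed_vector \<Rightarrow> 'b::banach"
  assumes "L-lipschitz_on UNIV f" "\<And>w. w \<in> cube zs \<Longrightarrow> norm (f (x + w)) \<le> B"
  shows "norm (foldr avg zs f x) \<le> B"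
  using assms(2)
proof (induction zs arbitrary: x)
  case (Cons z zs)
  have "norm (foldr avg zs f (x + t *\<^sub>R z)) \<le> B" if "0 \<le> t" "t \<le> 1" for t
    using Cons.prems[of "t *\<^sub>R z + w" for w] that
    by (intro Cons.IH) (auto simp: add.assoc)
  then show ?case
    by (auto intro!: avg_norm_le lipschitz_on_continuous_on avgs_lipschitz assms(1))
qed simp

text \<open>Averaging turns the identity into a translation, so increments are preserved
  exactly.\<close>

lemma avgs_id_diff: "foldr avg zs (\<lambda>x. x) (x + w) - foldr avg zs (\<lambda>x. x) x = (w::'a::banach)"
proof (induction zs arbitrary: x)
  case (Cons z zs)
  let ?g = "foldr avg zs (\<lambda>x. x)"
  have "1-lipschitz_on UNIV ?g" by (intro avgs_lipschitz) (simp add: lipschitz_on_def)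
  then have g: "continuous_on UNIV ?g" by (rule lipschitz_on_continuous_on)
  then have g': "continuous_on UNIV (\<lambda>x. ?g (x + w))"
    by (rule continuous_on_compose2) (auto intro!: continuous_intros)
  have "avg z ?g (x + w) - avg z ?g x = avg z (\<lambda>x. ?g (x + w) - ?g x) x"
    by (simp add: avg_diff[OF g' g] avg_translate)
  also have "\<dots> = w" unfolding Cons by (simp add: avg_def)
  finally show ?case by simp
qed simp

section \<open>The trace estimate\<close>

lemma lipschitz_on_id_diff:
  fixes f :: "'a::real_normed_vector \<Rightarrow> 'a"
  assumes "L-lipschitz_on UNIV f"
  shows "(L + 1)-lipschitz_on UNIV (\<lambda>x. f x - x)"
  by (intro lipschitz_on_diff assms) (simp add: lipschitz_on_def)

text \<open>\<open>D\<close> averages \<open>f\<close> over a box with edges along the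
  \<open>x i\<close> and the \<open>b k\<close>, so its derivatives are difference quotients of
  averages. Those along \<open>x i\<close> inherit the Lipschitz bound, and their images under
  \<open>V\<close> are small because \<open>V\<close> is small on the values of \<open>f\<close>.
  Those along \<open>b k\<close> are close to \<open>b k\<close> because the box stays within
  \<open>s\<close> of the ball of \<open>E\<close> on which \<open>f\<close> is the
  identity.\<close>

lemma averaged_derivative:
  fixes f :: "'a::banach \<Rightarrow> 'a" and V :: "'a \<Rightarrow> 'a" and x b :: "nat \<Rightarrow> 'a"
  assumes f: "L-lipschitz_on UNIV f" and E: "subspace E" and x0: "x0 \<in> E"
    and fixed: "\<And>u. u \<in> E \<Longrightarrow> norm (u - x0) \<le> r \<Longrightarrow> f u = u"
    and V: "bounded_linear V" and Vf: "\<And>x. norm (V (f x)) \<le> \<eta>"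
    and b: "\<And>k. k < d \<Longrightarrow> b k \<in> E" "\<And>k. k < d \<Longrightarrow> norm (b k) \<le> 1"
    and r: "0 < r" and s: "0 < s" and x: "0 < (\<Sum>i<m. norm (x i))"
  obtains D Db Dx where
    "\<And>i. i < m \<Longrightarrow> has_dirderiv D (x i) (Dx i)" "\<And>k. k < d \<Longrightarrow> has_dirderiv D (b k) (Db k)"
    "\<And>i. i < m \<Longrightarrow> norm (Dx i x0) \<le> L * norm (x i)"
    "\<And>i. i < m \<Longrightarrow> norm (V (Dx i x0)) \<le> 2 * \<eta> / s * (\<Sum>i<m. norm (x i))"
    "\<And>k. k < d \<Longrightarrow> norm (Db k x0 - b k) \<le> 2 * (L + 1) * s * (real d + 1) / r"
proof -
  define \<sigma> where "\<sigma> = (\<Sum>i<m. norm (x i))"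
  \<comment> \<open>\<open>a\<close> gives the edges along the \<open>x i\<close> total length
    \<open>s\<close>; \<open>\<rho>\<close> leaves room within radius \<open>r\<close> for
    \<open>d\<close> edges and one further increment along some \<open>b k\<close>.\<close>
  define a where "a = s / \<sigma>"
  define \<rho> where "\<rho> = r / (real d + 1)"
  have a: "a > 0" "a * \<sigma> = s" and \<rho>: "\<rho> > 0" using r s x by (auto simp: a_def \<rho>_def \<sigma>_def)
  define xs where "xs = map (\<lambda>i. a *\<^sub>R x i) [0..<m]"
  define bs where "bs = map (\<lambda>k. \<rho> *\<^sub>R b k) [0..<d]"
  define zs where "zs = xs @ bs"
  define D where "D = foldr avg zs f"
  define A where "A z = foldr avg (remove1 z zs) f" for z
  have A: "has_dirderiv D z (\<lambda>x. A z (x + z) - A z x)" if "z \<in> set zs" for z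
    unfolding D_def A_def by (rule has_dirderiv_avgs[OF f that])
  define Dx where "Dx i y = (1 / a) *\<^sub>R (A (a *\<^sub>R x i) (y + a *\<^sub>R x i) - A (a *\<^sub>R x i) y)" for i y
  define Db where "Db k y = (1 / \<rho>) *\<^sub>R (A (\<rho> *\<^sub>R b k) (y + \<rho> *\<^sub>R b k) - A (\<rho> *\<^sub>R b k) y)" for k y
  have zx: "a *\<^sub>R x i \<in> set zs" if "i < m" for i using that by (auto simp: zs_def xs_def)
  have zb: "\<rho> *\<^sub>R b k \<in> set zs" if "k < d" for k using that by (auto simp: zs_def bs_def)
  have 1: "has_dirderiv D (x i) (Dx i)" if "i < m" for i
    using has_dirderiv_scaleR[OF A[OF zx[OF that]], of "1 / a"] a by (simp add: Dx_def[abs_def])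
  have 2: "has_dirderiv D (b k) (Db k)" if "k < d" for k
    using has_dirderiv_scaleR[OF A[OF zb[OF that]], of "1 / \<rho>"] \<rho> by (simp add: Db_def[abs_def])
  have 3: "norm (Dx i x0) \<le> L * norm (x i)" if "i < m" for i
  proof -
    have "L-lipschitz_on UNIV (A (a *\<^sub>R x i))" unfolding A_def by (rule avgs_lipschitz[OF f])
    from lipschitz_onD[OF this, of "x0 + a *\<^sub>R x i" x0]
    have "norm (A (a *\<^sub>R x i) (x0 + a *\<^sub>R x i) - A (a *\<^sub>R x i) x0) \<le> L * (a * norm (x i))"
      using a by (simp add: dist_norm)
    moreover have "norm (Dx i x0) = norm (A (a *\<^sub>R x i) (x0 + a *\<^sub>R x i) - A (a *\<^sub>R x i) x0) / a"
      using a by (simp add: Dx_def)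
    ultimately show ?thesis using a by (simp add: pos_divide_le_eq mult_ac)
  qed
  have 4: "norm (V (Dx i x0)) \<le> 2 * \<eta> / s * (\<Sum>i<m. norm (x i))" if "i < m" for i
  proof -
    obtain K where K: "0 < K" "\<And>v. norm (V v) \<le> norm v * K"
      using bounded_linear.pos_bounded[OF V] by blast
    have "(K * L)-lipschitz_on UNIV (\<lambda>x. V (f x))"
    proof (rule lipschitz_onI)
      fix u v
      have "dist (V (f u)) (V (f v)) = norm (V (f u - f v))"
        by (simp add: dist_norm linear_diff[OF bounded_linear.linear[OF V]])
      also have "\<dots> \<le> K * dist (f u) (f v)" using K(2) by (simp add: dist_norm mult.commute)
      also have "\<dots> \<le> K * (L * dist u v)" using K(1) lipschitz_onD[OF f] by simp
      finally show "dist (V (f u)) (V (f v)) \<le> K * L * dist u v" by (simp add: mult.assoc)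
    qed (use K(1) lipschitz_on_nonneg[OF f] in simp)
    then have "norm (foldr avg ws (\<lambda>x. V (f x)) y) \<le> \<eta>" for ws y
      by (rule avgs_norm_le) (rule Vf)
    then have VA: "norm (V (A z y)) \<le> \<eta>" for z y
      by (simp add: A_def avgs_bounded_linear[OF f V])
    have "V (Dx i x0) = (1 / a) *\<^sub>R (V (A (a *\<^sub>R x i) (x0 + a *\<^sub>R x i)) - V (A (a *\<^sub>R x i) x0))"
      unfolding Dx_def by (simp only: linear_scale[OF bounded_linear.linear[OF V]] linear_diff[OF bounded_linear.linear[OF V]])
    also have "norm \<dots> \<le> (1 / a) * (\<eta> + \<eta>)"
      using a unfolding norm_scaleR
      by (intro mult_mono order_trans[OF norm_triangle_ineq4] add_mono VA) auto
    also have "\<dots> = 2 * \<eta> / s * (\<Sum>i<m. norm (x i))"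
      using s x by (simp add: a_def \<sigma>_def)
    finally show ?thesis .
  qed
  have 5: "norm (Db k x0 - b k) \<le> 2 * (L + 1) * s * (real d + 1) / r" if k: "k < d" for k
  proof -
    let ?z = "\<rho> *\<^sub>R b k"
    let ?q = "\<lambda>x. f x - x"
    let ?F = "foldr avg (remove1 ?z zs)"
    have L: "0 \<le> L" by (rule lipschitz_on_nonneg[OF f])
    have q: "(L + 1)-lipschitz_on UNIV ?q" by (rule lipschitz_on_id_diff[OF f])
    have sx: "(\<Sum>z\<leftarrow>xs. norm z) = s"
      using a by (simp add: xs_def o_def sum_distrib_left[symmetric] interv_sum_list_conv_sum_set_nat \<sigma>_def lessThan_atLeast0)
    have sb: "(\<Sum>z\<leftarrow>bs. norm z) \<le> real d * \<rho>"
    proof -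
      have "(\<Sum>z\<leftarrow>bs. norm z) = (\<Sum>k<d. \<rho> * norm (b k))"
        using \<rho> by (simp add: bs_def o_def interv_sum_list_conv_sum_set_nat lessThan_atLeast0)
      also have "\<dots> \<le> (\<Sum>k<d. \<rho>)" using b \<rho> by (intro sum_mono) (auto intro!: mult_left_le)
      finally show ?thesis by simp
    qed
    have rem: "(\<Sum>w\<leftarrow>remove1 ?z ws. norm w) \<le> (\<Sum>w\<leftarrow>ws. norm w)" for ws :: "'a list"
      by (induction ws) auto
    \<comment> \<open>The removed vector may coincide with an edge in \<open>xs\<close>, which comes
      first in \<open>zs\<close>. In either case the length bounds survive and the second part stays
      in \<open>E\<close>.\<close>
    obtain xs' bs' where split: "remove1 ?z zs = xs' @ bs'" and xs': "(\<Sum>z\<leftarrow>xs'. norm z) \<le> s"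
      and bs': "(\<Sum>z\<leftarrow>bs'. norm z) \<le> real d * \<rho>" "set bs' \<subseteq> E"
    proof -
      have bE: "set bs \<subseteq> E" using b(1) subspace_scale[OF E] by (auto simp: bs_def)
      show thesis
      proof (cases "?z \<in> set xs")
        case True
        then show thesis using that[of "remove1 ?z xs" bs] rem[of xs] sx sb bE
          by (simp add: zs_def remove1_append)
      next
        case False
        then show thesis using that[of xs "remove1 ?z bs"] rem[of bs] sx sb bE set_remove1_subset[of ?z bs]
          by (simp add: zs_def remove1_append)
      qed
    qed
    \<comment> \<open>\<open>u\<close> collects the edges along the \<open>x i\<close> and
      \<open>v\<close> those in \<open>E\<close>: \<open>y + v\<close> is a fixed point of
      \<open>f\<close>, and \<open>y + w\<close> lies within \<open>s\<close> of it.\<close>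
    have near: "norm (?q (y + w)) \<le> (L + 1) * s"
      if w: "w \<in> cube (xs' @ bs')" and y: "y \<in> E" "norm (y - x0) \<le> \<rho>" for y w
    proof -
      obtain u v where u: "u \<in> cube xs'" and v: "v \<in> cube bs'" and w: "w = u + v"
        using cube_append[OF w] by blast
      have "v \<in> E" using v cube_subset_span[of bs'] span_minimal[OF bs'(2) E] by blast
      then have yv: "y + v \<in> E" using y(1) E by (simp add: subspace_add)
      have "norm (y + v - x0) \<le> norm (y - x0) + norm v"
        using norm_triangle_ineq[of "y - x0" v] by (simp add: algebra_simps)
      also have "\<dots> \<le> \<rho> + real d * \<rho>" using y cube_norm_le[OF v] bs'(1) by linarith
      also have "\<dots> = (real d + 1) * \<rho>" by (simp add: algebra_simps)
      also have "\<dots> = r" by (simp add: \<rho>_def)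
      finally have "?q (y + v) = 0" using fixed[OF yv] by simp
      then have "norm (?q (y + w)) \<le> (L + 1) * norm u"
        using lipschitz_onD[OF q, of "y + w" "y + v"] by (simp add: dist_norm w)
      also have "\<dots> \<le> (L + 1) * s"
        using L cube_norm_le[OF u] xs' by (intro mult_left_mono) auto
      finally show ?thesis .
    qed
    have "norm (b k) * \<rho> \<le> \<rho>" using b(2)[OF k] \<rho> by (simp add: mult_le_cancel_right1)
    then have "norm (?q (x0 + ?z + w)) \<le> (L + 1) * s" "norm (?q (x0 + w)) \<le> (L + 1) * s"
      if "w \<in> cube (remove1 ?z zs)" for w
      using near[of w "x0 + ?z"] near[of w x0] x0 b(1)[OF k] E \<rho> that[unfolded split]
      by (simp_all add: subspace_add subspace_scale mult.commute)
    then have "norm (?F ?q (x0 + ?z)) \<le> (L + 1) * s" "norm (?F ?q x0) \<le> (L + 1) * s"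
      by (blast intro: avgs_norm_le[OF q])+
    moreover have "?F ?q (x0 + ?z) - ?F ?q x0 = (A ?z (x0 + ?z) - A ?z x0) - ?z"
    proof -
      have "?F ?q = (\<lambda>x. ?F f x - ?F (\<lambda>x. x) x)"
        by (rule avgs_diff[OF f, of 1]) (simp add: lipschitz_on_def)
      then have "?F ?q (x0 + ?z) - ?F ?q x0 =
          (A ?z (x0 + ?z) - A ?z x0) - (?F (\<lambda>x. x) (x0 + ?z) - ?F (\<lambda>x. x) x0)"
        by (simp add: A_def)
      then show ?thesis by (simp only: avgs_id_diff)
    qed
    ultimately have "norm ((A ?z (x0 + ?z) - A ?z x0) - ?z) \<le> 2 * ((L + 1) * s)"
      using norm_triangle_ineq4[of "?F ?q (x0 + ?z)" "?F ?q x0"] by simp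
    moreover have "Db k x0 - b k = (1 / \<rho>) *\<^sub>R ((A ?z (x0 + ?z) - A ?z x0) - ?z)"
      using \<rho> by (simp add: Db_def scaleR_diff_right)
    then have "norm (Db k x0 - b k) = norm ((A ?z (x0 + ?z) - A ?z x0) - ?z) / \<rho>"
      using \<rho> by simp
    ultimately have "norm (Db k x0 - b k) \<le> 2 * ((L + 1) * s) / \<rho>"
      using \<rho> by (simp add: divide_right_mono)
    then show ?thesis by (simp add: \<rho>_def mult_ac)
  qed
  show thesis by (rule that[OF 1 2 3 4 5])
qed

text \<open>The left side is the trace on \<open>E\<close> of the operator
  \<open>\<Sum>i. \<phi> i \<otimes> x i\<close>. Composing with the averaged derivative, nearly the
  identity on \<open>E\<close>, hardly changes it; the new trace is a sum of terms
  \<open>\<phi> i (Q (Dx i x0))\<close>, each at most about \<open>L * norm (x i)\<close>.\<close>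

lemma trace_bound:
  fixes f :: "'a::banach \<Rightarrow> 'a" and g \<phi> :: "nat \<Rightarrow> 'a \<Rightarrow> real" and x b :: "nat \<Rightarrow> 'a"
  assumes f: "L-lipschitz_on UNIV f" and E: "subspace E" and x0: "x0 \<in> E"
    and fixed: "\<And>u. u \<in> E \<Longrightarrow> norm (u - x0) \<le> r \<Longrightarrow> f u = u"
    and near: "\<And>x. \<exists>y\<in>E. norm (f x - y) \<le> h"
    and b: "\<And>k. k < d \<Longrightarrow> b k \<in> E" "\<And>k. k < d \<Longrightarrow> norm (b k) \<le> 1"
    and g: "\<And>k. k < d \<Longrightarrow> linear (g k)" "\<And>k x. k < d \<Longrightarrow> \<bar>g k x\<bar> \<le> 2 * norm x"
    and rep: "\<And>y. y \<in> E \<Longrightarrow> (\<Sum>k<d. g k y *\<^sub>R b k) = y"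
    and \<phi>: "\<And>i. i < m \<Longrightarrow> linear (\<phi> i)" "\<And>i x. i < m \<Longrightarrow> \<bar>\<phi> i x\<bar> \<le> norm x"
    and S: "\<And>k. k < d \<Longrightarrow> (\<Sum>i<m. \<phi> i (b k) *\<^sub>R x i) \<in> E"
    and r: "0 < r" and s: "0 < s"
  shows "(\<Sum>k<d. \<Sum>i<m. \<phi> i (b k) * g k (x i)) \<le>
    (L + 2 * real m * (2 * real d + 1) * h / s + 8 * (real d)\<^sup>2 * (L + 1) * s * (real d + 1) / r) *
      (\<Sum>i<m. norm (x i))"
proof (cases "(\<Sum>i<m. norm (x i)) = 0")
  \<comment> \<open>The degenerate case is separated because the box edges are scaled by
    \<open>s\<close> over this sum.\<close>
  case True
  then have "x i = 0" if "i < m" for i using that by (simp add: sum_nonneg_eq_0_iff)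
  then have "(\<Sum>k<d. \<Sum>i<m. \<phi> i (b k) * g k (x i)) = 0"
    using linear_0[OF g(1)] by (intro sum.neutral ballI) simp
  then show ?thesis using True by simp
next
  case False
  define \<sigma> where "\<sigma> = (\<Sum>i<m. norm (x i))"
  have "\<sigma> \<ge> 0" by (simp add: \<sigma>_def sum_nonneg)
  then have \<sigma>: "\<sigma> > 0" using False by (simp add: \<sigma>_def)
  \<comment> \<open>A crude projection onto \<open>E\<close>, of norm at most \<open>2 * d\<close>.
    The map \<open>V = Q - id\<close> vanishes on \<open>E\<close>, so it is small on the values of
    \<open>f\<close>, which lie within \<open>h\<close> of \<open>E\<close>.\<close>
  define Q where "Q v = (\<Sum>k<d. g k v *\<^sub>R b k)" for v
  have Qlin: "linear Q" unfolding Q_def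
    by (auto intro!: linearI simp: linear_add[OF g(1)] linear_scale[OF g(1)] algebra_simps
        sum.distrib scaleR_sum_right)
  have Qnorm: "norm (Q v) \<le> 2 * real d * norm v" for v
  proof -
    have "norm (Q v) \<le> (\<Sum>k<d. 2 * norm v)" unfolding Q_def
    proof (rule sum_norm_le)
      fix k assume "k \<in> {..<d}"
      then show "norm (g k v *\<^sub>R b k) \<le> 2 * norm v"
        using mult_mono[OF g(2)[of k v] b(2)[of k]] by simp
    qed
    then show ?thesis by simp
  qed
  define V where "V v = Q v - v" for v
  have Vlin: "linear V" unfolding V_def
    by (auto intro!: linearI simp: linear_add[OF Qlin] linear_scale[OF Qlin] algebra_simps)
  have Vnorm: "norm (V v) \<le> (2 * real d + 1) * norm v" for v
    using norm_triangle_ineq4[of "Q v" v] Qnorm[of v] by (simp add: V_def algebra_simps)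
  have VE: "V y = 0" if "y \<in> E" for y using rep[OF that] by (simp add: V_def Q_def)
  have Vb: "bounded_linear V"
    using Vlin Vnorm by (intro bounded_linear_intro[of _ "2 * real d + 1"])
      (auto simp: linear_add linear_scale mult.commute)
  define \<eta> where "\<eta> = (2 * real d + 1) * h"
  have Vf: "norm (V (f x)) \<le> \<eta>" for x
  proof -
    obtain y where y: "y \<in> E" "norm (f x - y) \<le> h" using near by blast
    have "V (f x) = V (f x - y)" using VE[OF y(1)] by (simp add: linear_diff[OF Vlin])
    also have "norm \<dots> \<le> (2 * real d + 1) * norm (f x - y)" by (rule Vnorm)
    also have "\<dots> \<le> \<eta>" unfolding \<eta>_def using y by (intro mult_left_mono) auto
    finally show ?thesis .
  qed
  obtain D Db Dx where D:
    "\<And>i. i < m \<Longrightarrow> has_dirderiv D (x i) (Dx i)" "\<And>k. k < d \<Longrightarrow> has_dirderiv D (b k) (Db k)"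
    "\<And>i. i < m \<Longrightarrow> norm (Dx i x0) \<le> L * norm (x i)"
    "\<And>i. i < m \<Longrightarrow> norm (V (Dx i x0)) \<le> 2 * \<eta> / s * \<sigma>"
    "\<And>k. k < d \<Longrightarrow> norm (Db k x0 - b k) \<le> 2 * (L + 1) * s * (real d + 1) / r"
    by (rule averaged_derivative[OF f E x0 fixed Vb Vf b r s, where x = x and m = m and d = d,
        folded \<sigma>_def]) (assumption | rule \<sigma> | rule that)+
  define \<kappa> where "\<kappa> = 2 * (L + 1) * s * (real d + 1) / r"
  define S where "S k = (\<Sum>i<m. \<phi> i (b k) *\<^sub>R x i)" for k
  have SE: "S k \<in> E" if "k < d" for k unfolding S_def by (rule assms(13)[OF that])
  \<comment> \<open>\<open>S k\<close> is a combination of the \<open>x i\<close> and also of the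
    \<open>b l\<close>; uniqueness of directional derivatives identifies the two expressions. This
    supplies the linearity of the derivative.\<close>
  have DS: "(\<Sum>i<m. \<phi> i (b k) *\<^sub>R Dx i x0) = (\<Sum>l<d. g l (S k) *\<^sub>R Db l x0)" if k: "k < d" for k
  proof -
    have "has_dirderiv D (S k) (\<lambda>y. \<Sum>i<m. \<phi> i (b k) *\<^sub>R Dx i y)"
      unfolding S_def by (intro has_dirderiv_sum has_dirderiv_scaleR D(1)) auto
    moreover have "has_dirderiv D (\<Sum>l<d. g l (S k) *\<^sub>R b l) (\<lambda>y. \<Sum>l<d. g l (S k) *\<^sub>R Db l y)"
      by (intro has_dirderiv_sum has_dirderiv_scaleR D(2)) auto
    ultimately show ?thesis unfolding rep[OF SE[OF k]] by (rule has_dirderiv_unique)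
  qed
  have Snorm: "norm (S k) \<le> \<sigma>" if "k < d" for k
    unfolding S_def \<sigma>_def
  proof (rule sum_norm_le)
    fix i assume "i \<in> {..<m}"
    then have "\<bar>\<phi> i (b k)\<bar> \<le> 1" using order_trans[OF \<phi>(2) b(2)[OF that]] by simp
    then show "norm (\<phi> i (b k) *\<^sub>R x i) \<le> norm (x i)" by (simp add: mult_left_le_one_le)
  qed
  \<comment> \<open>The cost of replacing the averaged derivative by the identity on
    \<open>E\<close>: \<open>d\<close> summands of size \<open>2 * \<sigma> * \<kappa>\<close>,
    doubled by \<open>g k\<close>.\<close>
  have tr1: "g k (S k) \<le> (\<Sum>i<m. \<phi> i (b k) * g k (Dx i x0)) + 4 * real d * \<sigma> * \<kappa>" if k: "k < d" for k
  proof -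
    let ?y = "\<Sum>l<d. g l (S k) *\<^sub>R (Db l x0 - b l)"
    have "norm ?y \<le> (\<Sum>l<d. (2 * \<sigma>) * \<kappa>)"
    proof (rule sum_norm_le)
      fix l assume l: "l \<in> {..<d}"
      have "\<bar>g l (S k)\<bar> \<le> 2 * \<sigma>" using g(2)[of l "S k"] Snorm[OF k] l by simp
      then show "norm (g l (S k) *\<^sub>R (Db l x0 - b l)) \<le> (2 * \<sigma>) * \<kappa>"
        using D(5)[of l] l \<sigma> unfolding \<kappa>_def by (simp only: norm_scaleR, intro mult_mono) auto
    qed
    then have y: "norm ?y \<le> 2 * real d * \<sigma> * \<kappa>" by (simp add: mult_ac)
    have "(\<Sum>i<m. \<phi> i (b k) * g k (Dx i x0)) = g k (\<Sum>i<m. \<phi> i (b k) *\<^sub>R Dx i x0)"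
      by (simp add: linear_sum[OF g(1)[OF k]] linear_scale[OF g(1)[OF k]])
    also have "\<dots> = g k (S k + ?y)"
      unfolding DS[OF k] by (simp add: scaleR_diff_right sum_subtractf rep[OF SE[OF k]])
    also have "\<dots> = g k (S k) + g k ?y" by (rule linear_add[OF g(1)[OF k]])
    finally show ?thesis using g(2)[OF k, of ?y] y by (simp add: abs_le_iff)
  qed
  have tr2: "\<phi> i (Q (Dx i x0)) \<le> L * norm (x i) + 2 * \<eta> / s * \<sigma>" if i: "i < m" for i
  proof -
    have "\<phi> i (Q (Dx i x0)) \<le> norm (Q (Dx i x0))" using \<phi>(2)[OF i] abs_le_D1 by blast
    also have "\<dots> = norm (Dx i x0 + V (Dx i x0))" by (simp add: V_def)
    also have "\<dots> \<le> L * norm (x i) + 2 * \<eta> / s * \<sigma>"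
      by (intro order_trans[OF norm_triangle_ineq] add_mono D(3,4) i)
    finally show ?thesis .
  qed
  have "(\<Sum>k<d. \<Sum>i<m. \<phi> i (b k) * g k (x i)) = (\<Sum>k<d. g k (S k))"
    unfolding S_def by (intro sum.cong) (auto simp: linear_sum[OF g(1)] linear_scale[OF g(1)])
  also have "\<dots> \<le> (\<Sum>k<d. (\<Sum>i<m. \<phi> i (b k) * g k (Dx i x0)) + 4 * real d * \<sigma> * \<kappa>)"
    by (intro sum_mono tr1) simp
  also have "\<dots> = (\<Sum>k<d. \<Sum>i<m. \<phi> i (b k) * g k (Dx i x0)) + 4 * (real d)\<^sup>2 * \<sigma> * \<kappa>"
    by (simp add: sum.distrib power2_eq_square)
  \<comment> \<open>After interchanging the sums only the norm bound for \<open>\<phi> i\<close>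
    enters, so no power of the dimension multiplies \<open>L\<close>.\<close>
  also have "(\<Sum>k<d. \<Sum>i<m. \<phi> i (b k) * g k (Dx i x0)) = (\<Sum>i<m. \<phi> i (Q (Dx i x0)))"
    unfolding Q_def by (subst sum.swap, intro sum.cong)
      (auto simp: linear_sum[OF \<phi>(1)] linear_scale[OF \<phi>(1)] mult.commute)
  also have "\<dots> \<le> (\<Sum>i<m. L * norm (x i) + 2 * \<eta> / s * \<sigma>)"
    by (intro sum_mono tr2) simp
  also have "\<dots> = L * \<sigma> + real m * (2 * \<eta> / s * \<sigma>)"
    by (simp add: sum.distrib \<sigma>_def sum_distrib_left)
  finally show ?thesis unfolding \<sigma>_def[symmetric] \<eta>_def \<kappa>_def by (simp add: algebra_simps)
qed

section \<open>Projections onto finite-dimensional subspaces\<close>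

definition single_bcontfun :: "nat \<Rightarrow> 'a::real_normed_vector \<Rightarrow> nat \<Rightarrow>\<^sub>C 'a" where
  "single_bcontfun i x = Bcontfun (\<lambda>j. if j = i then x else 0)"

lemma apply_single_bcontfun: "apply_bcontfun (single_bcontfun i x) j = (if j = i then x else 0)"
proof -
  have "bounded (range (\<lambda>j. if j = i then x else 0))"
    by (rule bounded_subset[of "{x, 0}"]) auto
  then have "(\<lambda>j. if j = i then x else 0) \<in> bcontfun"
    by (simp add: bcontfun_def)
  then show ?thesis by (simp add: single_bcontfun_def Bcontfun_inverse)
qed

lemma linear_single_bcontfun: "linear (single_bcontfun i)"
  by (rule linearI) (auto intro!: bcontfun_eqI simp: apply_single_bcontfun)

text \<open>Trace duality: \<open>trace_bound\<close> dominates the trace on tuples whose operator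
  maps \<open>E\<close> into itself. A Hahn-Banach extension to all tuples splits into one
  functional \<open>\<mu> i\<close> per slot, of norm at most \<open>C\<close>. These have the form
  \<open>\<phi> i\<close> composed with a projection \<open>T\<close> onto \<open>E\<close>, and the
  first \<open>M\<close> of the \<open>\<phi> i\<close> norm \<open>E\<close> up to the factor
  \<open>1 - \<epsilon>\<close>.\<close>

lemma projection_exists:
  fixes f :: "'a::banach \<Rightarrow> 'a" and B :: "'a set"
  assumes f: "L-lipschitz_on UNIV f" and B: "finite B" "independent B" and x0: "x0 \<in> span B"
    and fixed: "\<And>u. u \<in> span B \<Longrightarrow> norm (u - x0) \<le> r \<Longrightarrow> f u = u"
    and near: "\<And>x. \<exists>y\<in>span B. norm (f x - y) \<le> h"
    and r: "0 < r" and s: "0 < s" and h: "0 \<le> h" and \<epsilon>: "0 < \<epsilon>" "\<epsilon> < 1"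
    and C: "L + 2 * ((1 + 2 / \<epsilon>) ^ card B + real (card B)) * (2 * real (card B) + 1) * h / s
      + 8 * (real (card B))\<^sup>2 * (L + 1) * s * (real (card B) + 1) / r \<le> C"
  obtains P :: "'a \<Rightarrow>\<^sub>L 'a"
  where "P o\<^sub>L P = P" "range (blinfun_apply P) = span B" "norm P \<le> C / (1 - \<epsilon>)"
proof -
  define E where "E = span B"
  have E: "subspace E" by (simp add: E_def)
  define d where "d = card B"
  obtain b g where b: "\<And>k. k < d \<Longrightarrow> b k \<in> E" "\<And>k. k < d \<Longrightarrow> norm (b k) \<le> 1"
    and g: "\<And>k. k < d \<Longrightarrow> linear (g k)" "\<And>k x. k < d \<Longrightarrow> \<bar>g k x\<bar> \<le> 2 * norm x"
    and rep: "\<And>y. y \<in> E \<Longrightarrow> (\<Sum>k<d. g k y *\<^sub>R b k) = y"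
    by (rule near_auerbach_basis[OF B, folded d_def E_def]) (rule that)
  obtain S where S: "finite S" "S \<subseteq> E" "\<And>z. z \<in> S \<Longrightarrow> norm z = 1" "real (card S) \<le> (1 + 2 / \<epsilon>) ^ d"
    and net: "\<And>y. y \<in> E \<Longrightarrow> norm y = 1 \<Longrightarrow> \<exists>z\<in>S. norm (y - z) < \<epsilon>"
    by (rule finite_net_exists[OF b(2) g(2) rep E \<epsilon>(1)]) (assumption | rule that)+
  define M where "M = card S"
  obtain z where z: "bij_betw z {..<M} S"
    using ex_bij_betw_nat_finite[OF S(1)] by (auto simp: M_def lessThan_atLeast0)
  have "\<exists>\<psi>. linear \<psi> \<and> (\<forall>x. \<bar>\<psi> x\<bar> \<le> norm x) \<and> \<psi> (z i) = norm (z i)" for i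
    by (rule norming_functional[of "z i"]) blast
  then obtain \<psi> where \<psi>: "\<And>i. linear (\<psi> i)" "\<And>i x. \<bar>\<psi> i x\<bar> \<le> norm x" "\<And>i. \<psi> i (z i) = norm (z i)"
    by metis
  define m where "m = M + d"
  \<comment> \<open>The functionals \<open>g k / 2\<close> are added to the norming ones, so that the coordinates of the
    projection can be read off from the extended trace.\<close>
  define \<phi> where "\<phi> i = (if i < M then \<psi> i else (\<lambda>x. g (i - M) x / 2))" for i
  have \<phi>_lin: "linear (\<phi> i)" if "i < m" for i
  proof (cases "i < M")
    case False
    then have l: "linear (g (i - M))" using that by (intro g) (auto simp: m_def)
    show ?thesis using False
      by (auto intro!: linearI simp: \<phi>_def linear_add[OF l] linear_scale[OF l] add_divide_distrib)
  qed (simp add: \<phi>_def \<psi>)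
  have \<phi>_le: "\<bar>\<phi> i x\<bar> \<le> norm x" if "i < m" for i x
  proof (cases "i < M")
    case False
    then have "\<bar>g (i - M) x\<bar> \<le> 2 * norm x" using that by (intro g) (auto simp: m_def)
    then show ?thesis using False by (simp add: \<phi>_def)
  qed (simp add: \<phi>_def \<psi>)
  have \<phi>_g: "\<phi> (M + k) x = g k x / 2" for k x by (simp add: \<phi>_def)
  \<comment> \<open>\<open>\<lambda>y. \<Theta> y v\<close> is the operator \<open>\<Sum>i. \<phi> i \<otimes> v i\<close>; the type \<open>nat \<Rightarrow>\<^sub>C 'a\<close> serves as the vector
    space of tuples, of which only the first \<open>m\<close> entries matter.\<close>
  define \<Theta> where "\<Theta> y v = (\<Sum>i<m. \<phi> i y *\<^sub>R apply_bcontfun v i)" for y and v :: "nat \<Rightarrow>\<^sub>C 'a"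
  have \<Theta>_lin: "linear (\<Theta> y)" for y unfolding \<Theta>_def
    by (auto intro!: linearI simp: scaleR_add_right sum.distrib scaleR_sum_right mult.commute)
  have \<Theta>_single: "\<Theta> y (single_bcontfun i x) = \<phi> i y *\<^sub>R x" if "i < m" for y i x
  proof -
    have "\<Theta> y (single_bcontfun i x) = (\<Sum>j<m. if j = i then \<phi> i y *\<^sub>R x else 0)"
      unfolding \<Theta>_def by (intro sum.cong) (auto simp: apply_single_bcontfun)
    then show ?thesis using that by simp
  qed
  define tr where "tr v = (\<Sum>k<d. g k (\<Theta> (b k) v))" for v
  have tr_lin: "linear tr"
    by (auto intro!: linearI simp: tr_def linear_add[OF \<Theta>_lin] linear_scale[OF \<Theta>_lin]
        linear_add[OF g(1)] linear_scale[OF g(1)] sum.distrib sum_distrib_left)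
  define p where "p v = C * (\<Sum>i<m. norm (apply_bcontfun v i))" for v :: "nat \<Rightarrow>\<^sub>C 'a"
  have L: "0 \<le> L" by (rule lipschitz_on_nonneg[OF f])
  have "0 \<le> L + 2 * ((1 + 2 / \<epsilon>) ^ d + real d) * (2 * real d + 1) * h / s
      + 8 * (real d)\<^sup>2 * (L + 1) * s * (real d + 1) / r"
    using L h s r \<epsilon> by (intro add_nonneg_nonneg divide_nonneg_nonneg mult_nonneg_nonneg) auto
  then have C0: "0 \<le> C" using C unfolding d_def by linarith
  define W where "W = {v. \<forall>k<d. \<Theta> (b k) v \<in> E}"
  define G where "G = (\<lambda>v. (v, tr v)) ` W"
  have subW: "subspace W" unfolding W_def subspace_def
    using subspace_0[OF E] subspace_add[OF E] subspace_scale[OF E]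
    by (auto simp: linear_add[OF \<Theta>_lin] linear_scale[OF \<Theta>_lin] linear_0[OF \<Theta>_lin])
  have subG: "subspace G" unfolding G_def
    by (intro linear_subspace_image subW)
      (auto intro!: linearI simp: linear_add[OF tr_lin] linear_scale[OF tr_lin])
  have tr_le: "tr v \<le> p v" if "v \<in> W" for v
  proof -
    have S': "(\<Sum>i<m. \<phi> i (b k) *\<^sub>R apply_bcontfun v i) \<in> E" if "k < d" for k
      using \<open>v \<in> W\<close> that by (simp add: W_def \<Theta>_def)
    have "tr v = (\<Sum>k<d. \<Sum>i<m. \<phi> i (b k) * g k (apply_bcontfun v i))"
      unfolding tr_def \<Theta>_def by (intro sum.cong) (auto simp: linear_sum[OF g(1)] linear_scale[OF g(1)])
    also have "\<dots> \<le> (L + 2 * real m * (2 * real d + 1) * h / s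
        + 8 * (real d)\<^sup>2 * (L + 1) * s * (real d + 1) / r) * (\<Sum>i<m. norm (apply_bcontfun v i))"
      by (rule trace_bound[OF f E x0[folded E_def] fixed[folded E_def] near[folded E_def]
            b g rep \<phi>_lin \<phi>_le S' r s]) assumption+
    also have "\<dots> \<le> p v" unfolding p_def
    proof (rule mult_right_mono)
      have "2 * real m * (2 * real d + 1) * h / s \<le>
          2 * ((1 + 2 / \<epsilon>) ^ d + real d) * (2 * real d + 1) * h / s"
        using S(4) h s by (intro divide_right_mono mult_right_mono mult_left_mono) (auto simp: m_def M_def)
      then show "L + 2 * real m * (2 * real d + 1) * h / s
        + 8 * (real d)\<^sup>2 * (L + 1) * s * (real d + 1) / r \<le> C"
        using C unfolding d_def by linarith
    qed (simp add: sum_nonneg)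
    finally show ?thesis .
  qed
  have p_add: "p (u + v) \<le> p u + p v" for u v
  proof -
    have "(\<Sum>i<m. norm (apply_bcontfun (u + v) i)) \<le>
        (\<Sum>i<m. norm (apply_bcontfun u i) + norm (apply_bcontfun v i))"
      by (intro sum_mono) (simp add: norm_triangle_ineq)
    from mult_left_mono[OF this C0] show ?thesis by (simp add: p_def sum.distrib distrib_left)
  qed
  have p_scale: "p (c *\<^sub>R v) = c * p v" if "0 \<le> c" for c v
    using that by (simp add: p_def sum_distrib_left mult_ac)
  have G_le: "a \<le> p v" if "(v, a) \<in> G" for v a using that tr_le by (auto simp: G_def)
  obtain \<Lambda> where \<Lambda>: "linear \<Lambda>" "\<And>v. \<Lambda> v \<le> p v" "\<And>v a. (v, a) \<in> G \<Longrightarrow> \<Lambda> v = a"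
    by (rule hahn_banach_graph[OF p_add p_scale subG G_le]) (assumption | rule that)+
  have \<Lambda>W: "\<Lambda> v = tr v" if "v \<in> W" for v using \<Lambda>(3) that by (auto simp: G_def)
  define \<mu> where "\<mu> i x = \<Lambda> (single_bcontfun i x)" for i x
  have \<mu>_lin: "linear (\<mu> i)" for i
    using linear_compose[OF linear_single_bcontfun \<Lambda>(1)] by (simp add: \<mu>_def[abs_def] o_def)
  have \<mu>_le: "\<bar>\<mu> i x\<bar> \<le> C * norm x" if "i < m" for i x
  proof -
    have "\<mu> i x \<le> C * norm x" for x
    proof -
      have "p (single_bcontfun i x) = C * (\<Sum>j<m. if j = i then norm x else 0)"
        unfolding p_def by (intro arg_cong[where f = "(*) C"] sum.cong) (auto simp: apply_single_bcontfun)
      then show ?thesis using \<Lambda>(2)[of "single_bcontfun i x"] that by (simp add: \<mu>_def)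
    qed
    from this[of x] this[of "- x"] show ?thesis by (simp add: linear_neg[OF \<mu>_lin] abs_le_iff)
  qed
  \<comment> \<open>The slots from \<open>M\<close> on carry \<open>g k / 2\<close>; the factor 2
    undoes the halving, so \<open>2 * \<mu> (M + k)\<close> extends the coordinate
    \<open>g k\<close> from \<open>E\<close>.\<close>
  define T where "T x = (\<Sum>k<d. (2 * \<mu> (M + k) x) *\<^sub>R b k)" for x
  have T_lin: "linear T" unfolding T_def
    by (auto intro!: linearI simp: linear_add[OF \<mu>_lin] linear_scale[OF \<mu>_lin] algebra_simps
        sum.distrib scaleR_sum_right)
  have TE: "T x \<in> E" for x unfolding T_def by (intro subspace_sum[OF E] subspace_scale[OF E] b) simp
  \<comment> \<open>For \<open>y\<close> in \<open>E\<close> the tuple with single entry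
    \<open>y\<close> represents an operator with values in \<open>E\<close>; there the extension
    equals the trace, which is \<open>\<phi> (M + k) y\<close>.\<close>
  have T_id: "T y = y" if y: "y \<in> E" for y
  proof -
    have "2 * \<mu> (M + k) y = g k y" if k: "k < d" for k
    proof -
      have km: "M + k < m" using k by (simp add: m_def)
      have "single_bcontfun (M + k) y \<in> W"
        using y subspace_scale[OF E] by (simp add: W_def \<Theta>_single[OF km])
      then have "\<mu> (M + k) y = (\<Sum>l<d. g l (\<phi> (M + k) (b l) *\<^sub>R y))"
        by (simp add: \<mu>_def \<Lambda>W tr_def \<Theta>_single[OF km])
      also have "\<dots> = (\<Sum>l<d. \<phi> (M + k) (g l y *\<^sub>R b l))"
        by (intro sum.cong) (auto simp: linear_scale[OF g(1)] linear_scale[OF \<phi>_lin[OF km]])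
      also have "\<dots> = \<phi> (M + k) y" by (simp add: linear_sum[OF \<phi>_lin[OF km], symmetric] rep[OF y])
      finally show ?thesis by (simp add: \<phi>_g)
    qed
    then show ?thesis using rep[OF y] by (simp add: T_def)
  qed
  have \<mu>_T: "\<mu> i x = \<phi> i (T x)" if i: "i < m" for i x
  proof -
    \<comment> \<open>On \<open>E\<close> the functional \<open>\<phi> i\<close> is the combination
      of the \<open>\<phi> (M + k)\<close> with coefficients \<open>2 * \<phi> i (b k)\<close>.
      Hence \<open>v\<close> represents the zero operator on \<open>E\<close>, and the extension
      vanishes at \<open>v\<close>.\<close>
    define v where "v = single_bcontfun i x - (\<Sum>k<d. (2 * \<phi> i (b k)) *\<^sub>R single_bcontfun (M + k) x)"
    have \<Theta>v: "\<Theta> y v = 0" if "y \<in> E" for y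
    proof -
      have "\<Theta> y v = \<phi> i y *\<^sub>R x - (\<Sum>k<d. (2 * \<phi> i (b k)) *\<^sub>R \<Theta> y (single_bcontfun (M + k) x))"
        by (simp add: v_def linear_diff[OF \<Theta>_lin] linear_sum[OF \<Theta>_lin] linear_scale[OF \<Theta>_lin] \<Theta>_single i)
      also have "(\<Sum>k<d. (2 * \<phi> i (b k)) *\<^sub>R \<Theta> y (single_bcontfun (M + k) x)) =
          (\<Sum>k<d. \<phi> i (g k y *\<^sub>R b k) *\<^sub>R x)"
        by (intro sum.cong) (auto simp: \<Theta>_single m_def \<phi>_g linear_scale[OF \<phi>_lin[OF i]] mult.commute)
      also have "\<dots> = \<phi> i y *\<^sub>R x"
        by (simp add: scaleR_sum_left[symmetric] linear_sum[OF \<phi>_lin[OF i], symmetric] rep[OF that])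
      finally show ?thesis by simp
    qed
    have "v \<in> W" using \<Theta>v b subspace_0[OF E] by (simp add: W_def)
    then have "\<Lambda> v = tr v" by (rule \<Lambda>W)
    also have "\<dots> = 0" unfolding tr_def using \<Theta>v b linear_0[OF g(1)] by (intro sum.neutral) simp
    finally have "\<mu> i x = (\<Sum>k<d. (2 * \<phi> i (b k)) * \<mu> (M + k) x)"
      by (simp add: v_def linear_diff[OF \<Lambda>(1)] linear_sum[OF \<Lambda>(1)] linear_scale[OF \<Lambda>(1)] \<mu>_def)
    also have "\<dots> = \<phi> i (T x)"
      by (simp add: T_def linear_sum[OF \<phi>_lin[OF i]] linear_scale[OF \<phi>_lin[OF i]] mult_ac)
    finally show ?thesis .
  qed
  \<comment> \<open>The normalised \<open>T x\<close> is within \<open>\<epsilon>\<close> of some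
    \<open>z i\<close>, so \<open>\<phi> i\<close> is at least \<open>1 - \<epsilon>\<close> on it,
    while \<open>\<phi> i (T x) = \<mu> i x\<close> is at most \<open>C * norm x\<close>.\<close>
  have T_norm: "norm (T x) \<le> C / (1 - \<epsilon>) * norm x" for x
  proof (cases "T x = 0")
    case True then show ?thesis using C0 \<epsilon> by simp
  next
    case False
    define u where "u = (1 / norm (T x)) *\<^sub>R T x"
    have "u \<in> E" "norm u = 1" using False TE subspace_scale[OF E] by (auto simp: u_def)
    then obtain w where "w \<in> S" "norm (u - w) < \<epsilon>" using net by blast
    then obtain i where i: "i < M" "norm (u - z i) < \<epsilon>" "z i \<in> S"
      using z by (auto simp: bij_betw_def)
    have im: "i < m" using i by (simp add: m_def)
    have "\<phi> i (z i) = 1" using i S(3) by (simp add: \<phi>_def \<psi>)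
    moreover have "\<bar>\<phi> i (u - z i)\<bar> < \<epsilon>" using \<phi>_le[OF im, of "u - z i"] i by linarith
    ultimately have "1 - \<epsilon> \<le> \<phi> i u" by (simp add: linear_diff[OF \<phi>_lin[OF im]])
    also have "\<phi> i u = \<phi> i (T x) / norm (T x)" by (simp add: u_def linear_scale[OF \<phi>_lin[OF im]])
    also have "\<dots> \<le> C * norm x / norm (T x)"
      using \<mu>_le[OF im, of x] \<mu>_T[OF im, of x] by (intro divide_right_mono) auto
    finally show ?thesis using False \<epsilon> by (simp add: field_simps)
  qed
  have T_bl: "bounded_linear T"
    using T_norm by (intro bounded_linear_intro[of _ "C / (1 - \<epsilon>)"])
      (auto simp: linear_add[OF T_lin] linear_scale[OF T_lin] mult.commute)
  show thesis
  proof (rule that[of "Blinfun T"])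
    show "Blinfun T o\<^sub>L Blinfun T = Blinfun T"
      by (rule blinfun_eqI) (simp add: bounded_linear_Blinfun_apply[OF T_bl] T_id TE)
    show "range (blinfun_apply (Blinfun T)) = span B"
      unfolding bounded_linear_Blinfun_apply[OF T_bl] E_def[symmetric]
      using TE T_id by (metis image_subsetI rangeI subsetI subset_antisym)
    show "norm (Blinfun T) \<le> C / (1 - \<epsilon>)"
      using T_norm C0 \<epsilon> by (intro norm_blinfun_bound) (auto simp: bounded_linear_Blinfun_apply[OF T_bl])
  qed
qed

section \<open>Small sets\<close>

lemma infdist_lessE:
  assumes "infdist x A < c" "A \<noteq> {}"
  obtains y where "y \<in> A" "dist x y < c"
proof (rule ccontr)
  assume "\<not> thesis"
  then have "\<forall>y\<in>A. c \<le> dist x y" using that by (meson not_less)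
  then have "c \<le> infdist x A" using assms(2) by (auto simp: infdist_def intro!: cINF_greatest)
  then show False using assms(1) by simp
qed

lemma seq_span_mono: "m \<le> n \<Longrightarrow> seq_span e m \<subseteq> seq_span e n"
  unfolding seq_span_def by (intro span_mono image_mono) auto

text \<open>The \<open>ennreal\<close> conventions make height and inner radius positive and finite.
  Since extremal radii and nearest points may fail to exist, a radius above half the inner radius
  and twice the height are used, whence the factor 4.\<close>

lemma small_ratio_radii:
  fixes K :: "'a::real_normed_vector set"
  assumes pos: "0 < height e K n / inner_radius e K n"
    and le: "height e K n / inner_radius e K n \<le> ennreal c"
  obtains r h x0 where "0 < r" "0 \<le> h" "h \<le> 4 * c * r" "x0 \<in> seq_span e n"
    "cball x0 r \<inter> seq_span e n \<subseteq> K" "\<And>x. x \<in> K \<Longrightarrow> \<exists>y\<in>seq_span e n. norm (x - y) \<le> h"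
proof -
  let ?H = "height e K n" and ?I = "inner_radius e K n"
  have H0: "?H \<noteq> 0" using pos by auto
  have fin: "?H / ?I \<noteq> \<infinity>" using le by (auto simp: top_unique)
  have I0: "?I \<noteq> 0" using fin H0 by (auto simp: ennreal_divide_zero)
  have I1: "?I \<noteq> \<infinity>" using pos by auto
  have H1: "?H \<noteq> \<infinity>" using fin I1 by (auto simp: ennreal_top_divide)
  obtain H where H: "?H = ennreal H" "0 < H"
    using H0 H1 by (cases ?H) (auto simp: less_le)
  obtain I where I: "?I = ennreal I" "0 < I"
    using I0 I1 by (cases ?I) (auto simp: less_le)
  have "ennreal (H / I) \<le> ennreal c" using le H I by (simp add: divide_ennreal)
  then have HI: "H \<le> c * I" using H I by (simp add: ennreal_le_iff2 field_simps)
  have "ennreal (I / 2) < ?I" using I by (simp add: ennreal_less_iff)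
  then obtain r x0 where r: "0 \<le> r" "ennreal (I / 2) < ennreal r" "x0 \<in> seq_span e n"
      "cball x0 r \<inter> seq_span e n \<subseteq> K"
    unfolding inner_radius_def less_Sup_iff by auto
  have r2: "I / 2 < r" using r I by (simp add: ennreal_less_iff)
  show thesis
  proof (rule that[of r "2 * H" x0])
    show "0 < r" using r2 I by linarith
    have "0 < c * I" using HI H by linarith
    then have "c > 0" using I by (simp add: zero_less_mult_iff)
    then have "c * I \<le> c * (2 * r)" using r2 by (intro mult_left_mono) auto
    then show "2 * H \<le> 4 * c * r" using HI by linarith
    fix x assume x: "x \<in> K"
    have "ennreal (infdist x (seq_span e n)) \<le> ennreal H"
      unfolding H(1)[symmetric] height_def by (rule SUP_upper[OF x])
    then have "infdist x (seq_span e n) < 2 * H" using H by (simp add: ennreal_le_iff)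
    then obtain y where "y \<in> seq_span e n" "dist x y < 2 * H"
      using r(3) by (elim infdist_lessE) auto
    then show "\<exists>y\<in>seq_span e n. norm (x - y) \<le> 2 * H" by (auto simp: dist_norm intro!: bexI[of _ y])
  qed (use H r in auto)
qed

text \<open>With \<open>y = sqrt (q' / q) < 1\<close> the quotient of the two sides is
  \<open>A * (n * y ^ n)\<^sup>2\<close>, which tends to 0.\<close>

lemma eventually_poly_exp_le:
  fixes q q' A :: real
  assumes "0 < q'" "q' < q"
  shows "\<forall>\<^sub>F n in sequentially. A * (real n)\<^sup>2 * q' ^ n \<le> q ^ n"
proof -
  define y where "y = sqrt (q' / q)"
  have y: "0 < y" "y < 1" "y\<^sup>2 = q' / q" using assms by (auto simp: y_def)
  have "(\<lambda>n. real n * y ^ n) \<longlonglongrightarrow> 0" using y by (intro powser_times_n_limit_0) auto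
  then have "(\<lambda>n. A * (real n * y ^ n)\<^sup>2) \<longlonglongrightarrow> A * 0\<^sup>2" by (intro tendsto_intros)
  then have "\<forall>\<^sub>F n in sequentially. A * (real n * y ^ n)\<^sup>2 < 1" by (rule order_tendstoD(2)) simp
  then show ?thesis
  proof eventually_elim
    case (elim n)
    have "(real n * y ^ n)\<^sup>2 = (real n)\<^sup>2 * (q' ^ n / q ^ n)"
      unfolding power_mult_distrib power_divide[symmetric] y(3)[symmetric] by (simp flip: power_mult add: mult.commute)
    then have "A * (real n)\<^sup>2 * q' ^ n / q ^ n < 1" using elim by (simp add: mult.assoc)
    then show ?case using assms by (simp add: field_simps)
  qed
qed

section \<open>Choice of the parameters and convergence of the projections\<close>

theorem theorem4p7:
  fixes K :: "'a::banach set" and R :: "'a \<Rightarrow> 'a" and L :: real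
  assumes "separable_space (euclidean :: 'a topology)"
    and "small_set K" and "compact K"
    and "retraction UNIV K R" and "L-lipschitz_on UNIV R"
  shows "pi_property TYPE('a)"
proof -
  obtain \<epsilon> e \<sigma> where \<epsilon>: "0 < \<epsilon>" "\<epsilon> < (1::real)" and e: "fundamental_seq e"
    and \<sigma>: "strict_mono \<sigma>" "\<And>n::nat. 1 \<le> \<sigma> n"
    and ratio: "\<And>n. 0 < height e K (\<sigma> n) / inner_radius e K (\<sigma> n)"
      "\<And>n. height e K (\<sigma> n) / inner_radius e K (\<sigma> n)
        \<le> ennreal (1 / (2 * real (\<sigma> n)^2 * ((1 + 2 / \<epsilon>) ^ \<sigma> n + 2)))"
    using assms(2) unfolding small_set_def by blast
  have RK: "R x \<in> K" for x using assms(4) by (auto simp: retraction_def)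
  have Rid: "R x = x" if "x \<in> K" for x using assms(4) that by (auto simp: retraction_def)
  have L: "0 \<le> L" by (rule lipschitz_on_nonneg[OF assms(5)])
  \<comment> \<open>The midpoint gives \<open>q' < q\<close>, so \<open>(q / q') ^ N\<close>
    outgrows the polynomial factors, while \<open>1 - \<epsilon>'\<close> stays positive.\<close>
  define \<epsilon>' where "\<epsilon>' = (1 + \<epsilon>) / 2"
  have \<epsilon>': "0 < \<epsilon>'" "\<epsilon>' < 1" "\<epsilon> < \<epsilon>'" using \<epsilon> by (auto simp: \<epsilon>'_def)
  define q where "q = 1 + 2 / \<epsilon>"
  define q' where "q' = 1 + 2 / \<epsilon>'"
  have q: "2 \<le> q'" "q' < q" using \<epsilon> \<epsilon>' by (auto simp: q_def q'_def field_simps)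
  \<comment> \<open>The constant and the square come from the error term bounded in
    \<open>t2\<close>: \<open>768 * (L + 1) * N ^ 4\<close> divided by the factor
    \<open>2 * N\<^sup>2\<close> in the denominator of \<open>c\<close>.\<close>
  obtain N0 where N0: "\<And>N. N \<ge> N0 \<Longrightarrow> (384 * (L + 1)) * (real N)\<^sup>2 * q' ^ N \<le> q ^ N"
    using eventually_poly_exp_le[of q' q "384 * (L + 1)"] q by (auto simp: eventually_sequentially)
  have ex: "\<exists>P :: 'a \<Rightarrow>\<^sub>L 'a. P o\<^sub>L P = P \<and> range (blinfun_apply P) = seq_span e (\<sigma> n) \<and>
      norm P \<le> (L + 2) / (1 - \<epsilon>')" if n: "N0 \<le> n" for n
  proof -
    define N where "N = \<sigma> n"
    have N: "1 \<le> N" "N0 \<le> N" using \<sigma>(2) strict_mono_imp_increasing[OF \<sigma>(1), of n] n by (auto simp: N_def)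
    define c where "c = 1 / (2 * real N ^ 2 * (q ^ N + 2))"
    obtain r h x0 where r: "0 < r" and h: "0 \<le> h" "h \<le> 4 * c * r" and x0: "x0 \<in> seq_span e N"
      and ball: "cball x0 r \<inter> seq_span e N \<subseteq> K"
      and near: "\<And>x. x \<in> K \<Longrightarrow> \<exists>y\<in>seq_span e N. norm (x - y) \<le> h"
      using small_ratio_radii[of e K N c] ratio[of n] unfolding N_def c_def q_def by metis
    \<comment> \<open>The \<open>e i\<close> may be dependent, so the dimension \<open>d\<close> of
      the span may be smaller than \<open>N\<close>.\<close>
    obtain B where B: "B \<subseteq> e ` {..<N}" "independent B" "e ` {..<N} \<subseteq> span B"
      using maximal_independent_subset[of "e ` {..<N}"] by metis
    have spB: "span B = seq_span e N"
      unfolding seq_span_def using B by (metis span_mono span_span subset_antisym)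
    have finB: "finite B" using B(1) finite_subset by blast
    define d where "d = card B"
    have dN: "d \<le> N"
      using card_mono[OF _ B(1)] card_image_le[of "{..<N}" e] by (simp add: d_def)
    \<comment> \<open>With \<open>s = r / D\<close> the error term in \<open>t3\<close> is at most
      1, by \<open>d \<le> N\<close> and \<open>d + 1 \<le> 2 * N\<close>.\<close>
    define D where "D = 16 * (L + 1) * real N ^ 3"
    define s where "s = r / D"
    have D: "0 < D" using L N by (simp add: D_def)
    have s: "0 < s" using r D by (simp add: s_def)
    have "8 * (real d)\<^sup>2 * (L + 1) * s * (real d + 1) / r \<le> 8 * (real N)\<^sup>2 * (L + 1) * s * (2 * real N) / r"
      using dN N L s r by (intro divide_right_mono mult_mono power_mono) auto
    also have "\<dots> = D * s / r" by (simp add: D_def power2_eq_square power3_eq_cube)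
    also have "\<dots> = 1" using r D by (simp add: s_def)
    finally have t3: "8 * (real d)\<^sup>2 * (L + 1) * s * (real d + 1) / r \<le> 1" .
    have "real d \<le> q' ^ N"
    proof -
      have "real d \<le> real N" using dN by simp
      also have "\<dots> \<le> 2 ^ N" by (rule less_imp_le[OF of_nat_less_two_power])
      also have "\<dots> \<le> q' ^ N" using q by (intro power_mono) auto
      finally show ?thesis .
    qed
    moreover have "q' ^ d \<le> q' ^ N" using q dN by (intro power_increasing) auto
    ultimately have "q' ^ d + real d \<le> 2 * q' ^ N" by linarith
    \<comment> \<open>Here \<open>2 * d + 1 \<le> 3 * N\<close> and \<open>h \<le> 4 * c * r\<close>
      enter; afterwards \<open>r / s = D\<close> eliminates the radius.\<close>
    then have "2 * (q' ^ d + real d) * (2 * real d + 1) * h / s \<le> 2 * (2 * q' ^ N) * (3 * real N) * (4 * c * r) / s"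
      using dN N h s q by (intro divide_right_mono mult_mono) auto
    also have "\<dots> = 48 * q' ^ N * real N * c * D" using r D by (simp add: s_def)
    also have "\<dots> = 768 * (L + 1) * q' ^ N * real N ^ 4 * c"
      by (simp add: D_def power4_eq_xxxx power3_eq_cube)
    also have "\<dots> = (384 * (L + 1)) * (real N)\<^sup>2 * q' ^ N / (q ^ N + 2)"
    proof -
      obtain w where w: "w = q ^ N + 2" by blast
      have "0 < w" unfolding w using q by (simp add: add_pos_pos)
      have "768 * (L + 1) * q' ^ N * real N ^ 4 * c = 384 * ((L + 1) * (real N)\<^sup>2 * q' ^ N) / w"
        using N \<open>0 < w\<close> unfolding c_def w[symmetric]
        by (simp add: power4_eq_xxxx power2_eq_square field_simps)
      then show ?thesis unfolding w by (simp add: mult.assoc)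
    qed
    also have "\<dots> \<le> 1"
    proof -
      have "0 < q ^ N" using q by simp
      then show ?thesis using N0[OF N(2)] by (simp add: divide_le_eq_1)
    qed
    finally have t2: "2 * (q' ^ d + real d) * (2 * real d + 1) * h / s \<le> 1" .
    have fixed: "R u = u" if "u \<in> span B" "norm (u - x0) \<le> r" for u
      using that ball spB by (intro Rid) (auto simp: dist_norm norm_minus_commute)
    have near': "\<exists>y\<in>span B. norm (R x - y) \<le> h" for x using near[OF RK] spB by simp
    \<comment> \<open>Both error terms are at most 1, so \<open>L + 2\<close> bounds the trace
      constant independently of \<open>n\<close>.\<close>
    obtain P :: "'a \<Rightarrow>\<^sub>L 'a"
      where "P o\<^sub>L P = P" "range (blinfun_apply P) = span B" "norm P \<le> (L + 2) / (1 - \<epsilon>')"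
    proof (rule projection_exists[OF assms(5) finB B(2) _ fixed near' r s h(1) \<epsilon>'(1,2)])
      show "x0 \<in> span B" using x0 spB by simp
      show "L + 2 * ((1 + 2 / \<epsilon>') ^ card B + real (card B)) * (2 * real (card B) + 1) * h / s +
        8 * (real (card B))\<^sup>2 * (L + 1) * s * (real (card B) + 1) / r \<le> L + 2"
        using t2 t3 unfolding d_def q'_def by linarith
    qed auto
    then show ?thesis using spB unfolding N_def by auto
  qed
  define M where "M = (L + 2) / (1 - \<epsilon>')"
  have M: "0 \<le> M" using L \<epsilon>' by (simp add: M_def)
  obtain P :: "nat \<Rightarrow> 'a \<Rightarrow>\<^sub>L 'a" where P: "\<And>n. N0 \<le> n \<Longrightarrow> P n o\<^sub>L P n = P n"
    "\<And>n. N0 \<le> n \<Longrightarrow> range (blinfun_apply (P n)) = seq_span e (\<sigma> n)"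
    "\<And>n. N0 \<le> n \<Longrightarrow> norm (P n) \<le> M"
    using ex unfolding M_def by metis
  have id_on: "blinfun_apply (P n) y = y" if n: "N0 \<le> n" and y: "y \<in> seq_span e (\<sigma> n)" for n y
  proof -
    obtain x where "y = blinfun_apply (P n) x" using P(2)[OF n] y by blast
    then show ?thesis using P(1)[OF n] by (metis blinfun_apply_blinfun_compose)
  qed
  have "pi_net {N0..} (\<le>) P"
    unfolding pi_net_def
  proof (intro conjI allI impI)
    show "directed_set {N0..} (\<le>)"
      unfolding directed_set_def
      by auto (meson atLeast_iff le_trans max.cobounded1 max.cobounded2)
    show "\<forall>i\<in>{N0..}. finite_rank_projection (P i)"
      unfolding finite_rank_projection_def using P(1,2) by (auto simp: seq_span_def)
    show "\<exists>M. \<forall>i\<in>{N0..}. norm (P i) \<le> M" using P(3) by auto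
    fix x :: 'a and \<delta> :: real assume \<delta>: "\<delta> > 0"
    \<comment> \<open>The approximation error is amplified by at most \<open>M + 1\<close>; dividing
      by \<open>M + 2\<close> makes the final inequality strict.\<close>
    define \<eta> where "\<eta> = \<delta> / (M + 2)"
    have \<eta>: "\<eta> > 0" using \<delta> M by (simp add: \<eta>_def)
    have "x \<in> closure (span (range e))" using e by (simp add: fundamental_seq_def)
    then obtain y where y: "y \<in> span (range e)" "dist y x < \<eta>"
      using closure_approachable \<eta> by blast
    have "\<exists>m. y \<in> seq_span e m" using y(1)
    proof (induction rule: span_induct_alt)
      case base
      show ?case by (auto simp: seq_span_def intro: span_zero)
    next
      case (step c u v)
      then obtain i m where u: "u = e i" and v: "v \<in> seq_span e m" by auto
      \<comment> \<open>Indices start at 0, so \<open>e i\<close> belongs to the span of the first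
        \<open>Suc i\<close> vectors.\<close>
      have "u \<in> seq_span e (max m (Suc i))" unfolding seq_span_def u by (rule span_base) auto
      moreover have "v \<in> seq_span e (max m (Suc i))"
        using v seq_span_mono[of m "max m (Suc i)"] by auto
      ultimately have "c *\<^sub>R u + v \<in> seq_span e (max m (Suc i))"
        unfolding seq_span_def by (intro span_add span_scale)
      then show ?case by blast
    qed
    then obtain m where m: "y \<in> seq_span e m" by blast
    have "norm (blinfun_apply (P j) x - x) < \<delta>" if j: "N0 \<le> j" "m \<le> j" for j
    proof -
      have "m \<le> \<sigma> j" using strict_mono_imp_increasing[OF \<sigma>(1), of j] j by simp
      then have "y \<in> seq_span e (\<sigma> j)" using m seq_span_mono by blast
      then have "blinfun_apply (P j) x - x = blinfun_apply (P j) (x - y) - (x - y)"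
        using id_on[OF j(1)] by (simp add: blinfun.diff_right)
      also have "norm \<dots> \<le> norm (blinfun_apply (P j) (x - y)) + norm (x - y)"
        by (rule norm_triangle_ineq4)
      also have "\<dots> \<le> M * norm (x - y) + norm (x - y)"
        using order_trans[OF norm_blinfun mult_right_mono[OF P(3)[OF j(1)]]] by simp
      also have "\<dots> = (M + 1) * norm (x - y)" by (simp add: algebra_simps)
      also have "\<dots> \<le> (M + 1) * \<eta>"
        using y(2) M by (intro mult_left_mono) (auto simp: dist_norm norm_minus_commute)
      also have "\<dots> < (M + 2) * \<eta>" using \<eta> by simp
      also have "\<dots> = \<delta>" using M by (simp add: \<eta>_def)
      finally show ?thesis .
    qed
    then show "\<exists>i\<in>{N0..}. \<forall>j\<in>{N0..}. i \<le> j \<longrightarrow> norm (blinfun_apply (P j) x - x) < \<delta>"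
      by (intro bexI[of _ "max N0 m"]) auto
  qed
  then show ?thesis by (rule pi_propertyI)
qed

end
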